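(* Let $k$ be an algebraically closed field of characteristic zero and let $X=V(f)\subset\mathbb{P}^2$ be a reduced hypersurface of degree $d\geq 2$ over $k$. Then $X=V(f)$ has vanishing Hessian (i.e. $h_f\equiv 0$) if and only if $X$ is a cone, i.e. if and only if $X$ consists of $d$ distinct lines through a point.
   Context: For homogeneous $f\in k[x_0,\ldots,x_n]$ the Hessian polynomial is $h_f:=\det\left(\frac{\partial^2 f}{\partial x_i\partial x_j}\right)_{i,j=0,\ldots,n}$. A hypersurface $X=V(f)\subset\mathbb{P}^n$ is a cone if, modulo projective transformations of $\mathbb{P}^n$, the equation defining $X$ does not depend on all the variables. *)

theory Defs
  imports
    "HOL-Analysis.Analysis"
    "HOL-Library.Poly_Mapping"
    "HOL-Computational_Algebra.Squarefree"
begin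

text \<open>Polynomials over \<open>'a\<close> in variables indexed by the finite type \<open>'n\<close>: finitely supported
  maps from exponent vectors to coefficients, with the convolution product of
  \<^theory>\<open>HOL-Library.Poly_Mapping\<close>. For \<open>'n = 3\<close> the indices are \<open>0, 1, 2\<close>.\<close>

type_synonym ('n, 'a) mvpoly = "('n \<Rightarrow>\<^sub>0 nat) \<Rightarrow>\<^sub>0 'a"

definition mv_const :: "'a \<Rightarrow> ('n, 'a::comm_ring_1) mvpoly" where
  "mv_const c = Poly_Mapping.single 0 c"

definition mv_var :: "'n \<Rightarrow> ('n, 'a::comm_ring_1) mvpoly" where
  "mv_var i = Poly_Mapping.single (Poly_Mapping.single i 1) 1"

definition mv_eval :: "('n::finite, 'a::comm_ring_1) mvpoly \<Rightarrow> 'a^'n \<Rightarrow> 'a" where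
  "mv_eval f v =
     (\<Sum>m\<in>Poly_Mapping.keys f. Poly_Mapping.lookup f m * (\<Prod>i\<in>UNIV. (v $ i) ^ Poly_Mapping.lookup m i))"

definition mv_homogeneous :: "nat \<Rightarrow> ('n::finite, 'a::comm_ring_1) mvpoly \<Rightarrow> bool" where
  "mv_homogeneous d f \<longleftrightarrow>
     (\<forall>m\<in>Poly_Mapping.keys f. (\<Sum>i\<in>UNIV. Poly_Mapping.lookup m i) = d)"

text \<open>The truncated subtraction of exponents below is harmless: where it truncates, the factor
  \<open>of_nat (lookup m i)\<close> is zero.\<close>

definition mv_pderiv :: "'n \<Rightarrow> ('n, 'a::comm_ring_1) mvpoly \<Rightarrow> ('n, 'a) mvpoly" where
  "mv_pderiv i f =
     (\<Sum>m\<in>Poly_Mapping.keys f.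
        Poly_Mapping.single (m - Poly_Mapping.single i 1)
          (of_nat (Poly_Mapping.lookup m i) * Poly_Mapping.lookup f m))"

definition hessian_poly :: "('n::finite, 'a::comm_ring_1) mvpoly \<Rightarrow> ('n, 'a) mvpoly" where
  "hessian_poly f = det (\<chi> i j. mv_pderiv i (mv_pderiv j f))"

text \<open>The substitution \<open>x\<^sub>i \<mapsto> \<Sum>\<^sub>j A\<^sub>i\<^sub>j x\<^sub>j\<close>, i.e. the polynomial \<open>f(A x)\<close>.\<close>

definition mv_linear_subst ::
  "'a^'n^'n \<Rightarrow> ('n::finite, 'a::comm_ring_1) mvpoly \<Rightarrow> ('n, 'a) mvpoly" where
  "mv_linear_subst A f =
     (\<Sum>m\<in>Poly_Mapping.keys f. mv_const (Poly_Mapping.lookup f m) *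
        (\<Prod>i\<in>UNIV. (\<Sum>j\<in>UNIV. mv_const (A $ i $ j) * mv_var j) ^ Poly_Mapping.lookup m i))"

definition mv_depends_on :: "('n, 'a::comm_ring_1) mvpoly \<Rightarrow> 'n \<Rightarrow> bool" where
  "mv_depends_on f i \<longleftrightarrow> (\<exists>m\<in>Poly_Mapping.keys f. Poly_Mapping.lookup m i \<noteq> 0)"

definition is_cone :: "('n::finite, 'a::field) mvpoly \<Rightarrow> bool" where
  "is_cone f \<longleftrightarrow>
     (\<exists>A :: 'a^'n^'n. invertible A \<and> \<not> (\<forall>i. mv_depends_on (mv_linear_subst A f) i))"

text \<open>A point of the projective space of \<open>'a^'n\<close> (of dimension \<open>CARD('n) - 1\<close>) is the set of its
  homogeneous coordinate vectors.\<close>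

definition proj_point :: "'a::field^'n \<Rightarrow> ('a^'n) set" where
  "proj_point v = {c *s v | c. c \<noteq> 0}"

definition proj_space :: "('a::field^'n) set set" where
  "proj_space = {proj_point v | v. v \<noteq> 0}"

text \<open>Meaningful for homogeneous \<open>f\<close>, where vanishing does not depend on the chosen
  coordinate vector.\<close>

definition proj_zeros :: "('n::finite, 'a::field) mvpoly \<Rightarrow> ('a^'n) set set" where
  "proj_zeros f = {p \<in> proj_space. \<forall>v\<in>p. mv_eval f v = 0}"

definition proj_line :: "('a::field^3) set set \<Rightarrow> bool" where
  "proj_line L \<longleftrightarrow> (\<exists>l. mv_homogeneous 1 l \<and> l \<noteq> 0 \<and> L = proj_zeros l)"

text \<open>\<open>X\<close> is given by its set of points, which determines a reduced plane curve over an algebraically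
  closed field.\<close>

definition concurrent_lines :: "nat \<Rightarrow> ('a::field^3) set set \<Rightarrow> bool" where
  "concurrent_lines d X \<longleftrightarrow>
     (\<exists>S p. finite S \<and> card S = d \<and> (\<forall>L\<in>S. proj_line L) \<and>
        p \<in> proj_space \<and> (\<forall>L\<in>S. p \<in> L) \<and> X = \<Union>S)"

end

theory Submission
  imports Defs
begin

text \<open>Write \<open>D\<^sub>b f\<close> for the derivative of \<open>f\<close> in the direction \<open>b\<close>. Both \<open>is_cone\<close> and concurrency of
  lines amount to the existence of a vector \<open>b \<noteq> 0\<close> with \<open>D\<^sub>b f = 0\<close>.

  If \<open>f\<close> vanishes exactly on some lines through \<open>b\<close>, then \<open>t \<mapsto> f(x + t b)\<close> is either zero or
  without zeros, hence constant. Conversely, if \<open>D\<^sub>b f = 0\<close>, then \<open>f\<close> is a binary form, hence a product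
  of linear forms.

  Now let the Hessian determinant vanish, let \<open>H\<close> be the Hessian matrix and suppose that it has generic
  rank 2. Let \<open>x\<close> be a generic point and \<open>w\<close> span the kernel of \<open>H(x)\<close>. Differentiating \<open>det H = 0\<close> shows
  that \<open>t \<mapsto> H(x + t w) w\<close> solves a linear differential system with initial value 0, so the gradient of \<open>f\<close>
  is constant along \<open>x + t w\<close>. On the plane spanned by \<open>x\<close> and \<open>w\<close> the gradient is therefore
  proportional to its value at \<open>x\<close> and vanishes only on the line through \<open>w\<close>. Comparing two such
  planes along their intersection shows that generic kernels agree or generic gradients are parallel;
  either yields \<open>b\<close>. If the rank is at most 1, then \<open>d f f\<^sub>i\<^sub>j = (d - 1) f\<^sub>i f\<^sub>j\<close>, and every \<open>b\<close>
  orthogonal to the gradient at a point where \<open>f \<noteq> 0\<close> works.\<close>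

section \<open>Evaluation\<close>

lemma mv_eval_superset:
  assumes "finite S" "Poly_Mapping.keys f \<subseteq> S"
  shows "mv_eval f v = (\<Sum>m\<in>S. Poly_Mapping.lookup f m * (\<Prod>i\<in>UNIV. (v $ i) ^ Poly_Mapping.lookup m i))"
  unfolding mv_eval_def
  by (rule sum.mono_neutral_left) (use assms in \<open>auto simp: in_keys_iff\<close>)

lemma mv_eval_zero [simp]: "mv_eval 0 v = 0"
  by (simp add: mv_eval_def)

lemma mv_eval_single [simp]:
  "mv_eval (Poly_Mapping.single m c) v = c * (\<Prod>i\<in>UNIV. (v $ i) ^ Poly_Mapping.lookup m i)"
  by (subst mv_eval_superset[of "{m}"]) auto

lemma mv_eval_add [simp]: "mv_eval (f + g) v = mv_eval f v + mv_eval g v"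
proof -
  let ?S = "Poly_Mapping.keys f \<union> Poly_Mapping.keys g"
  have "Poly_Mapping.keys (f + g) \<subseteq> ?S"
    by (rule Poly_Mapping.keys_add)
  then show ?thesis
    by (simp add: mv_eval_superset[of ?S] lookup_add algebra_simps sum.distrib)
qed

lemma mv_eval_sum [simp]: "mv_eval (\<Sum>i\<in>S. f i) v = (\<Sum>i\<in>S. mv_eval (f i) v)"
  by (induction S rule: infinite_finite_induct) auto

lemma sum_single_keys:
  "(\<Sum>m\<in>Poly_Mapping.keys f. Poly_Mapping.single m (Poly_Mapping.lookup f m)) = f"
proof (rule poly_mapping_eqI)
  fix k
  show "Poly_Mapping.lookup (\<Sum>m\<in>Poly_Mapping.keys f. Poly_Mapping.single m (Poly_Mapping.lookup f m)) k
    = Poly_Mapping.lookup f k"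
    by (auto simp: lookup_sum lookup_single when_def in_keys_iff)
qed

lemma mv_eval_mult [simp]: "mv_eval (f * g) v = mv_eval f v * mv_eval g v"
proof -
  have "f * g = (\<Sum>m\<in>Poly_Mapping.keys f. \<Sum>n\<in>Poly_Mapping.keys g.
      Poly_Mapping.single (m + n) (Poly_Mapping.lookup f m * Poly_Mapping.lookup g n))"
    by (subst (1 2) sum_single_keys[symmetric]) (simp only: sum_product mult_single)
  then have "mv_eval (f * g) v = (\<Sum>m\<in>Poly_Mapping.keys f. \<Sum>n\<in>Poly_Mapping.keys g.
      (Poly_Mapping.lookup f m * Poly_Mapping.lookup g n) *
      (\<Prod>i\<in>UNIV. (v $ i) ^ Poly_Mapping.lookup (m + n) i))"
    by simp
  also have "\<dots> = mv_eval f v * mv_eval g v"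
    by (simp add: mv_eval_def sum_product lookup_add power_add prod.distrib mult_ac)
  finally show ?thesis .
qed

lemma mv_eval_const [simp]: "mv_eval (mv_const c) v = c"
  by (simp add: mv_const_def)

lemma mv_eval_one [simp]: "mv_eval 1 v = 1"
  by (subst single_one[symmetric]) (simp del: single_one)

lemma mv_eval_var [simp]: "mv_eval (mv_var i) v = v $ i"
  by (simp add: mv_var_def lookup_single when_def if_distrib[of "\<lambda>n. _ ^ n"] cong: if_cong)

lemma mv_eval_uminus [simp]: "mv_eval (- f) v = - mv_eval f v"
  using mv_eval_add[of f "- f" v] by (simp add: eq_neg_iff_add_eq_0 add.commute)

lemma mv_eval_diff [simp]: "mv_eval (f - g) v = mv_eval f v - mv_eval g v"
  using mv_eval_add[of f "- g" v] by simp

lemma mv_eval_prod [simp]: "mv_eval (\<Prod>i\<in>S. f i) v = (\<Prod>i\<in>S. mv_eval (f i) v)"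
  by (induction S rule: infinite_finite_induct) auto

lemma mv_eval_prod_mset [simp]: "mv_eval (\<Prod>i\<in>#M. f i) v = (\<Prod>i\<in>#M. mv_eval (f i) v)"
  by (induction M) auto

lemma mv_eval_power [simp]: "mv_eval (f ^ n) v = mv_eval f v ^ n"
  by (induction n) auto

lemma mv_eval_linear_subst: "mv_eval (mv_linear_subst A f) v = mv_eval f (A *v v)"
  by (simp add: mv_linear_subst_def mv_eval_def[of f] matrix_vector_mult_def)

lemma mv_eval_homogeneous:
  assumes "mv_homogeneous d f"
  shows "mv_eval f (c *s v) = c ^ d * mv_eval f v"
  using assms unfolding mv_eval_def mv_homogeneous_def
  by (auto simp: power_mult_distrib prod.distrib power_sum[symmetric] sum_distrib_left mult_ac
      intro!: sum.cong)

section \<open>Partial derivatives\<close>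

text \<open>Only \<open>m + single i 1\<close> lowers to \<open>m\<close> with a nonzero factor: an
  exponent \<open>n\<close> at which the subtraction truncates has
  \<open>lookup n i = 0\<close>.\<close>

lemma lookup_mv_pderiv:
  "Poly_Mapping.lookup (mv_pderiv i f) m =
    of_nat (Poly_Mapping.lookup m i + 1) * Poly_Mapping.lookup f (m + Poly_Mapping.single i 1)"
proof -
  let ?e = "Poly_Mapping.single i (1::nat)"
  have eq: "of_nat (Poly_Mapping.lookup n i) * Poly_Mapping.lookup f n * (if n - ?e = m then 1 else 0)
    = (if n = m + ?e then of_nat (Poly_Mapping.lookup m i + 1) * Poly_Mapping.lookup f (m + ?e) else 0)" for n
  proof (cases "n = m + ?e")
    case True
    then show ?thesis by (simp add: lookup_add)
  next
    case False
    have "Poly_Mapping.lookup n i = 0" if "n - ?e = m"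
    proof (rule ccontr)
      assume "Poly_Mapping.lookup n i \<noteq> 0"
      then have "n = (n - ?e) + ?e"
        by (intro poly_mapping_eqI) (auto simp: lookup_add lookup_minus lookup_single when_def)
      with that False show False by simp
    qed
    then show ?thesis using False by auto
  qed
  have "Poly_Mapping.lookup (mv_pderiv i f) m = (\<Sum>n\<in>Poly_Mapping.keys f.
     of_nat (Poly_Mapping.lookup n i) * Poly_Mapping.lookup f n * (if n - ?e = m then 1 else 0))"
    unfolding mv_pderiv_def
    by (auto simp: lookup_sum lookup_single when_def intro!: sum.cong)
  also have "\<dots> = of_nat (Poly_Mapping.lookup m i + 1) * Poly_Mapping.lookup f (m + ?e)"
    unfolding eq by (auto simp: in_keys_iff)
  finally show ?thesis .
qed

lemma mv_pderiv_commute: "mv_pderiv i (mv_pderiv j f) = mv_pderiv j (mv_pderiv i f)"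
  by (rule poly_mapping_eqI)
    (cases "i = j", auto simp: lookup_mv_pderiv lookup_add lookup_single when_def ac_simps)

lemma mv_homogeneous_pderiv:
  assumes "mv_homogeneous d f"
  shows "mv_homogeneous (d - 1) (mv_pderiv i f)"
  unfolding mv_homogeneous_def
proof
  fix m assume "m \<in> Poly_Mapping.keys (mv_pderiv i f)"
  then have "m + Poly_Mapping.single i 1 \<in> Poly_Mapping.keys f"
    by (auto simp: in_keys_iff lookup_mv_pderiv)
  with assms have "(\<Sum>j\<in>UNIV. Poly_Mapping.lookup (m + Poly_Mapping.single i 1) j) = d"
    by (auto simp: mv_homogeneous_def)
  then show "(\<Sum>j\<in>UNIV. Poly_Mapping.lookup m j) = d - 1"
    by (auto simp: lookup_add lookup_single sum.distrib when_def)
qed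

text \<open>In characteristic zero the exponent that multiplies a coefficient is nonzero in the
  field, so a term that contains the variable survives differentiation.\<close>

lemma mv_pderiv_eq_0_iff:
  fixes f :: "('n, 'a::field_char_0) mvpoly"
  shows "mv_pderiv i f = 0 \<longleftrightarrow> \<not> mv_depends_on f i"
proof
  assume *: "mv_pderiv i f = 0"
  show "\<not> mv_depends_on f i"
    unfolding mv_depends_on_def
  proof (intro notI, elim bexE)
    fix m assume m: "m \<in> Poly_Mapping.keys f" "Poly_Mapping.lookup m i \<noteq> 0"
    then have "m = (m - Poly_Mapping.single i 1) + Poly_Mapping.single i 1"
      by (intro poly_mapping_eqI) (auto simp: lookup_add lookup_minus lookup_single when_def)
    with lookup_mv_pderiv[of i f "m - Poly_Mapping.single i 1"] * m show False
      by (metis (no_types) Suc_eq_plus1 in_keys_iff lookup_zero mult_eq_0_iff of_nat_eq_0_iff nat.simps(3))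
  qed
next
  assume "\<not> mv_depends_on f i"
  then have "Poly_Mapping.lookup f (m + Poly_Mapping.single i 1) = 0" for m
    by (auto simp: mv_depends_on_def in_keys_iff lookup_add dest!: bspec[of _ _ "m + Poly_Mapping.single i 1"])
  then show "mv_pderiv i f = 0"
    by (intro poly_mapping_eqI) (simp add: lookup_mv_pderiv)
qed

section \<open>Restriction to a line\<close>

text \<open>The map \<open>t \<mapsto> f(x + t w)\<close> as a univariate polynomial, so that
  derivatives, degrees and roots in one variable apply.\<close>

definition mv_line :: "('n::finite, 'a::comm_ring_1) mvpoly \<Rightarrow> 'a^'n \<Rightarrow> 'a^'n \<Rightarrow> 'a poly" where
  "mv_line f x w = (\<Sum>m\<in>Poly_Mapping.keys f. smult (Poly_Mapping.lookup f m)
     (\<Prod>i\<in>UNIV. [:x $ i, w $ i:] ^ Poly_Mapping.lookup m i))"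

lemma poly_mv_line [simp]: "poly (mv_line f x w) t = mv_eval f (x + t *s w)"
  by (simp add: mv_line_def mv_eval_def poly_sum poly_prod mult_ac)

text \<open>A field of characteristic zero is infinite. Identities between restrictions to a line
  can therefore be checked by evaluation.\<close>

lemma poly_ext_char_0:
  fixes p q :: "'a::field_char_0 poly"
  assumes "\<And>t. poly p t = poly q t"
  shows "p = q"
  using assms poly_eq_poly_eq_iff[of p q] by blast

lemma mv_line_diff: "mv_line (f - g) x w = mv_line f x w - mv_line g x w"
  and mv_line_mult: "mv_line (f * g) x w = mv_line f x w * mv_line g x w"
  and mv_line_const: "mv_line (mv_const c) x w = [:c:]"
  and mv_line_zero: "mv_line 0 x w = 0"
  and mv_line_sum: "mv_line (\<Sum>i\<in>S. h i) x w = (\<Sum>i\<in>S. mv_line (h i) x w)"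
  for f g :: "('n::finite, 'a::field_char_0) mvpoly"
  by (rule poly_ext_char_0; simp add: poly_sum)+

lemma mv_line_single:
  fixes c :: "'a::field_char_0"
  shows "mv_line (Poly_Mapping.single m c) x w =
    smult c (\<Prod>i\<in>UNIV. [:x $ i, w $ i:] ^ Poly_Mapping.lookup m i)"
  by (rule poly_ext_char_0) (simp add: poly_prod mult_ac)

lemma pderiv_sum_fun: "pderiv (\<Sum>i\<in>S. p i) = (\<Sum>i\<in>S. pderiv (p i))"
  by (induction S rule: infinite_finite_induct) (auto simp: pderiv_add)

lemma smult_sum_right: "smult c (\<Sum>i\<in>S. p i) = (\<Sum>i\<in>S. smult c (p i))"
  by (induction S rule: infinite_finite_induct) (auto simp: smult_add_right)

text \<open>The chain rule, monomial by monomial: the product rule over the variables, then an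
  exchange of the two sums.\<close>

lemma pderiv_mv_line:
  fixes f :: "('n::finite, 'a::field_char_0) mvpoly"
  shows "pderiv (mv_line f x w) = (\<Sum>i\<in>UNIV. smult (w $ i) (mv_line (mv_pderiv i f) x w))"
proof -
  let ?l = "\<lambda>i. [:x $ i, w $ i:]" and ?k = "Poly_Mapping.lookup"
  \<comment> \<open>Both sides truncate alike when \<open>i\<close> does not occur in
    \<open>m\<close>.\<close>
  have rest: "(\<Prod>j\<in>UNIV. ?l j ^ ?k (m - Poly_Mapping.single i 1) j) =
      (\<Prod>j\<in>UNIV - {i}. ?l j ^ ?k m j) * ?l i ^ (?k m i - 1)" for m i
  proof -
    have "(\<Prod>j\<in>UNIV. ?l j ^ ?k (m - Poly_Mapping.single i 1) j) =
      ?l i ^ (?k m i - 1) * (\<Prod>j\<in>UNIV - {i}. ?l j ^ ?k (m - Poly_Mapping.single i 1) j)"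
      by (subst prod.remove[of _ i]) (auto simp: lookup_minus)
    also have "(\<Prod>j\<in>UNIV - {i}. ?l j ^ ?k (m - Poly_Mapping.single i 1) j) =
      (\<Prod>j\<in>UNIV - {i}. ?l j ^ ?k m j)"
      by (rule prod.cong) (auto simp: lookup_minus lookup_single when_def)
    finally show ?thesis by (simp add: mult.commute)
  qed
  have "pderiv (mv_line f x w) = (\<Sum>m\<in>Poly_Mapping.keys f. \<Sum>i\<in>UNIV.
      smult (?k f m) ((\<Prod>j\<in>UNIV - {i}. ?l j ^ ?k m j) *
        smult (of_nat (?k m i)) (?l i ^ (?k m i - 1) * [:w $ i:])))"
    by (simp add: mv_line_def pderiv_sum_fun pderiv_smult pderiv_prod pderiv_power pderiv_pCons
        smult_sum_right)
  also have "\<dots> = (\<Sum>i\<in>UNIV. \<Sum>m\<in>Poly_Mapping.keys f. smult (w $ i) (smult (of_nat (?k m i) * ?k f m)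
     (\<Prod>j\<in>UNIV. ?l j ^ ?k (m - Poly_Mapping.single i 1) j)))"
    unfolding rest by (subst sum.swap) (simp add: mult_ac)
  also have "\<dots> = (\<Sum>i\<in>UNIV. smult (w $ i) (mv_line (mv_pderiv i f) x w))"
    unfolding mv_pderiv_def[of _ f] mv_line_sum mv_line_single smult_sum_right ..
  finally show ?thesis .
qed

section \<open>Directional derivatives\<close>

definition mv_dirderiv :: "'a^'n \<Rightarrow> ('n::finite, 'a::comm_ring_1) mvpoly \<Rightarrow> ('n, 'a) mvpoly" where
  "mv_dirderiv b f = (\<Sum>i\<in>UNIV. mv_const (b $ i) * mv_pderiv i f)"

lemma mv_eval_dirderiv: "mv_eval (mv_dirderiv b f) v = (\<Sum>i\<in>UNIV. b $ i * mv_eval (mv_pderiv i f) v)"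
  by (simp add: mv_dirderiv_def)

lemma pderiv_mv_line_dirderiv:
  fixes f :: "('n::finite, 'a::field_char_0) mvpoly"
  shows "pderiv (mv_line f x w) = mv_line (mv_dirderiv w f) x w"
  by (simp add: pderiv_mv_line mv_dirderiv_def mv_line_sum mv_line_mult mv_line_const)

lemma mv_eval_dirderiv_line:
  fixes f :: "('n::finite, 'a::field_char_0) mvpoly"
  shows "mv_eval (mv_dirderiv w f) x = poly (pderiv (mv_line f x w)) 0"
  by (simp add: pderiv_mv_line_dirderiv)

lemma mv_dirderiv_axis: "mv_dirderiv (axis i 1) f = mv_pderiv i f"
proof -
  have "mv_const (axis i 1 $ j) * mv_pderiv j f = (if j = i then mv_pderiv i f else 0)" for j
    by (simp add: mv_const_def axis_def)
  then show ?thesis by (simp add: mv_dirderiv_def)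
qed

section \<open>Polynomials are determined by their values\<close>

lemma mv_eval_0:
  fixes f :: "('n::finite, 'a::comm_ring_1) mvpoly"
  shows "mv_eval f 0 = Poly_Mapping.lookup f 0"
proof -
  have "(\<Prod>i\<in>UNIV. (0::'a) ^ Poly_Mapping.lookup m i) = (if m = 0 then 1 else 0)"
    for m :: "'n \<Rightarrow>\<^sub>0 nat"
  proof (cases "m = 0")
    case False
    then obtain i where "Poly_Mapping.lookup m i \<noteq> 0"
      by (metis lookup_zero poly_mapping_eqI)
    with False show ?thesis by (auto simp: power_0_left intro!: prod_zero)
  qed simp
  then show ?thesis by (simp add: mv_eval_def in_keys_iff mult_delta_right)
qed

text \<open>Induction on the total degree of \<open>m\<close>. Vanishing everywhere passes to
  partial derivatives, and a nonzero integer multiple of the coefficient at \<open>m\<close> is a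
  coefficient of a partial derivative at an exponent of smaller degree. In degree zero the
  coefficient is the value at the origin.\<close>

lemma mv_eval_eq_0_imp:
  fixes f :: "('n::finite, 'a::field_char_0) mvpoly"
  assumes "\<And>v. mv_eval f v = 0"
  shows "f = 0"
proof (rule poly_mapping_eqI)
  fix m
  show "Poly_Mapping.lookup f m = Poly_Mapping.lookup 0 m"
    using assms
  proof (induction "\<Sum>i\<in>UNIV. Poly_Mapping.lookup m i" arbitrary: f m)
    case 0
    then have "m = 0" by (intro poly_mapping_eqI) auto
    with 0 show ?case by (metis mv_eval_0 lookup_zero)
  next
    case (Suc n)
    then obtain i where i: "Poly_Mapping.lookup m i \<noteq> 0"
      by (metis sum.neutral nat.simps(3))
    define m' where "m' = m - Poly_Mapping.single i 1"
    have m: "m = m' + Poly_Mapping.single i 1"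
      using i unfolding m'_def
      by (intro poly_mapping_eqI) (auto simp: lookup_add lookup_minus lookup_single when_def)
    have "mv_line f x w = 0" for x w
      by (rule poly_ext_char_0) (simp add: Suc.prems)
    then have "mv_eval (mv_pderiv i f) v = 0" for v
      by (metis mv_dirderiv_axis mv_eval_dirderiv_line pderiv_0 poly_0)
    moreover have "n = (\<Sum>j\<in>UNIV. Poly_Mapping.lookup m' j)"
      using Suc.hyps(2) by (simp add: m lookup_add lookup_single sum.distrib when_def)
    ultimately have "Poly_Mapping.lookup (mv_pderiv i f) m' = 0"
      using Suc.hyps(1) by (metis lookup_zero)
    then show ?case
      unfolding lookup_mv_pderiv m by (simp del: of_nat_add of_nat_Suc)
  qed
qed

lemma mv_eval_eqI:
  fixes f g :: "('n::finite, 'a::field_char_0) mvpoly"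
  assumes "\<And>v. mv_eval f v = mv_eval g v"
  shows "f = g"
  using mv_eval_eq_0_imp[of "f - g"] assms by simp

text \<open>On the line joining a point where \<open>f\<close> is nonzero to one where
  \<open>g\<close> is nonzero, both restrictions are nonzero polynomials in one variable, hence so
  is their product. This provides generic points, at which two polynomials are nonzero
  simultaneously.\<close>

lemma mv_eval_product_eq_0:
  fixes f g :: "('n::finite, 'a::field_char_0) mvpoly"
  assumes "\<And>v. mv_eval f v * mv_eval g v = 0"
  shows "f = 0 \<or> g = 0"
proof (rule ccontr)
  assume "\<not> ?thesis"
  then obtain x y where xy: "mv_eval f x \<noteq> 0" "mv_eval g y \<noteq> 0"
    using mv_eval_eq_0_imp by blast
  have "mv_line f x (y - x) * mv_line g x (y - x) = 0"
    by (rule poly_ext_char_0) (use assms in simp)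
  then have "poly (mv_line f x (y - x)) 0 = 0 \<or> poly (mv_line g x (y - x)) 1 = 0"
    by (metis mult_eq_0_iff poly_0)
  with xy show False by simp
qed

text \<open>Differentiate \<open>f(v + t v) = (1 + t)^d f(v)\<close> at
  \<open>t = 0\<close>.\<close>

lemma mv_euler:
  fixes f :: "('n::finite, 'a::field_char_0) mvpoly"
  assumes "mv_homogeneous d f"
  shows "(\<Sum>i\<in>UNIV. v $ i * mv_eval (mv_pderiv i f) v) = of_nat d * mv_eval f v"
proof -
  have "mv_line f v v = smult (mv_eval f v) ([:1, 1:] ^ d)"
  proof (rule poly_ext_char_0)
    fix t
    have "v + t *s v = (1 + t) *s v"
      by (simp add: vec_eq_iff algebra_simps)
    then have "mv_eval f (v + t *s v) = (1 + t) ^ d * mv_eval f v"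
      by (simp only: mv_eval_homogeneous[OF assms])
    then show "poly (mv_line f v v) t = poly (smult (mv_eval f v) ([:1, 1:] ^ d)) t"
      by simp
  qed
  then have "mv_eval (mv_dirderiv v f) v = of_nat d * mv_eval f v"
    by (simp add: mv_eval_dirderiv_line pderiv_smult pderiv_power pderiv_pCons)
  then show ?thesis by (simp add: mv_eval_dirderiv)
qed

lemma mv_eval_translate:
  fixes f :: "('n::finite, 'a::field_char_0) mvpoly"
  assumes "mv_dirderiv b f = 0"
  shows "mv_eval f (x + t *s b) = mv_eval f x"
proof -
  have "pderiv (mv_line f x b) = 0"
    by (simp add: pderiv_mv_line_dirderiv assms mv_line_zero)
  then obtain h where "mv_line f x b = [:h:]"
    using pderiv_iszero by blast
  then have "poly (mv_line f x b) t = poly (mv_line f x b) 0" by simp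
  then show ?thesis by simp
qed

lemma mv_dirderiv_linear_subst:
  fixes f :: "('n::finite, 'a::field_char_0) mvpoly"
  shows "mv_eval (mv_dirderiv w (mv_linear_subst A f)) x = mv_eval (mv_dirderiv (A *v w) f) (A *v x)"
proof -
  have "mv_line (mv_linear_subst A f) x w = mv_line f (A *v x) (A *v w)"
    by (rule poly_ext_char_0)
      (simp add: mv_eval_linear_subst matrix_vector_right_distrib vector_scalar_commute)
  then show ?thesis by (simp add: mv_eval_dirderiv_line)
qed

text \<open>By the chain rule, the derivative of \<open>f(A x)\<close> in the variable
  \<open>i\<close> is \<open>D\<^sub>b f\<close> at \<open>A x\<close>, where \<open>b\<close> is
  column \<open>i\<close> of \<open>A\<close>. This turns a missing variable into a coordinate-free
  condition.\<close>

lemma is_cone_iff_dirderiv: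
  fixes f :: "('n::finite, 'a::field_char_0) mvpoly"
  shows "is_cone f \<longleftrightarrow> (\<exists>b. b \<noteq> 0 \<and> mv_dirderiv b f = 0)"
proof
  assume "is_cone f"
  then obtain A i where A: "invertible A" "mv_pderiv i (mv_linear_subst A f) = 0"
    by (auto simp: is_cone_def mv_pderiv_eq_0_iff)
  from A(1) obtain B where B: "A ** B = mat 1" "B ** A = mat 1"
    by (auto simp: invertible_def)
  define b where "b = A *v axis i 1"
  have "mv_eval (mv_dirderiv b f) v = 0" for v
  proof -
    have "mv_eval (mv_dirderiv b f) v = mv_eval (mv_dirderiv b f) (A *v (B *v v))"
      by (simp add: matrix_vector_mul_assoc B)
    also have "\<dots> = 0"
      unfolding b_def mv_dirderiv_linear_subst[symmetric] by (simp add: mv_dirderiv_axis A)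
    finally show ?thesis .
  qed
  moreover have "b \<noteq> 0"
  proof
    assume "b = 0"
    then have "B *v (A *v axis i (1::'a)) = 0" by (simp add: b_def)
    then show False
      by (simp add: matrix_vector_mul_assoc B axis_eq_0_iff)
  qed
  ultimately show "\<exists>b. b \<noteq> 0 \<and> mv_dirderiv b f = 0"
    using mv_eval_eq_0_imp by blast
next
  assume "\<exists>b. b \<noteq> 0 \<and> mv_dirderiv b f = 0"
  then obtain b k where b: "mv_dirderiv b f = 0" "b $ k \<noteq> 0"
    by (auto simp: vec_eq_iff)
  \<comment> \<open>\<open>A\<close> is the identity matrix with column \<open>k\<close> replaced by
    \<open>b\<close>; as \<open>b $ k \<noteq> 0\<close> it has the inverse
    \<open>B\<close>.\<close>
  define A :: "'a^'n^'n" where "A = (\<chi> i j. if j = k then b $ i else if i = j then 1 else 0)"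
  define B :: "'a^'n^'n" where
    "B = (\<chi> i j. if j = k then (if i = k then 1 / b $ k else - b $ i / b $ k) else if i = j then 1 else 0)"
  have "A ** B = mat 1"
  proof -
    have "(\<Sum>l\<in>UNIV. A $ i $ l * B $ l $ j) = (if i = j then 1 else 0)" for i j
    proof -
      have "(\<Sum>l\<in>UNIV. A $ i $ l * B $ l $ j) =
        b $ i * B $ k $ j + (\<Sum>l\<in>UNIV - {k}. A $ i $ l * B $ l $ j)"
        by (subst sum.remove[of _ k]) (auto simp: A_def)
      also have "(\<Sum>l\<in>UNIV - {k}. A $ i $ l * B $ l $ j) =
        (\<Sum>l\<in>UNIV - {k}. if l = i then B $ i $ j else 0)"
        by (rule sum.cong) (auto simp: A_def)
      also have "\<dots> = (if i = k then 0 else B $ i $ j)"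
        by (simp add: sum.delta)
      finally show ?thesis using b by (auto simp: B_def)
    qed
    then show ?thesis by (simp add: matrix_matrix_mult_def mat_def vec_eq_iff)
  qed
  then have "invertible A"
    using matrix_left_right_inverse unfolding invertible_def by blast
  moreover have "A *v axis k 1 = b"
    by (simp add: vec_eq_iff matrix_vector_mult_def A_def axis_def mult_delta_right)
  then have "mv_pderiv k (mv_linear_subst A f) = 0"
    by (intro mv_eval_eq_0_imp)
      (simp add: mv_dirderiv_axis[symmetric] mv_dirderiv_linear_subst b)
  ultimately show "is_cone f"
    by (auto simp: is_cone_def mv_pderiv_eq_0_iff)
qed

section \<open>Three by three matrices\<close>

text \<open>Numerals of type \<open>3\<close> are read modulo 3; \<open>sum_3\<close> and
  \<open>det_3\<close> use the indices 1, 2, 3, the last of which is 0.\<close>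

lemma three_numerals: "(3::3) = 0" "(4::3) = 1" "(5::3) = 2"
  by simp_all

lemma three_add [simp]:
  "(i::3) + 1 + 1 = i + 2" "i + 1 + 2 = i" "i + 2 + 1 = i" "i + 2 + 2 = i + 1"
  "(i::3) + 1 \<noteq> i" "i + 2 \<noteq> i" "i + 1 \<noteq> i + 2" "i + 2 \<noteq> i + 1" "i \<noteq> i + 1" "i \<noteq> i + 2"
  using exhaust_3[of i] by auto

lemma three_cases:
  fixes i k :: 3
  obtains "i = k" | "i = k + 1" | "i = k + 2"
  using exhaust_3[of i] exhaust_3[of k] by fastforce

lemma sum_three: "(\<Sum>i\<in>UNIV. f i) = f k + f (k + 1) + f (k + 2)" for k :: 3
  using exhaust_3[of k] by (auto simp: sum_3 three_numerals add_ac)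

text \<open>Indices are added modulo 3, which absorbs the signs of the cofactors.\<close>

definition cof3 :: "(3 \<Rightarrow> 3 \<Rightarrow> 'a::comm_ring_1) \<Rightarrow> 3 \<Rightarrow> 3 \<Rightarrow> 'a" where
  "cof3 M i j = M (i + 1) (j + 1) * M (i + 2) (j + 2) - M (i + 1) (j + 2) * M (i + 2) (j + 1)"

definition det3 :: "(3 \<Rightarrow> 3 \<Rightarrow> 'a::comm_ring_1) \<Rightarrow> 'a" where
  "det3 M = (\<Sum>j\<in>UNIV. M 0 j * cof3 M 0 j)"

lemma det_eq_det3: "det (\<chi> i j. M i j) = det3 M"
  by (simp add: three_numerals det_3 det3_def cof3_def sum_3 algebra_simps)

lemma cof3_symmetric: "(\<And>i j. M i j = M j i) \<Longrightarrow> cof3 M i j = cof3 M j i"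
  unfolding cof3_def by (metis mult.commute)

lemma row_times_cof3: "(\<Sum>j\<in>UNIV. M i j * cof3 M k j) = (if i = k then det3 M else 0)"
  using exhaust_3[of i] exhaust_3[of k]
  by (elim disjE) (simp_all add: three_numerals sum_3 det3_def cof3_def algebra_simps)

text \<open>The adjugate of the adjugate. If the determinant vanishes, so do all 2x2 minors of the
  cofactor matrix, which then has rank at most one.\<close>

lemma cof3_cof3: "cof3 (cof3 M) i j = det3 M * M i j"
  using exhaust_3[of i] exhaust_3[of j]
  by (elim disjE) (simp_all add: three_numerals sum_3 det3_def cof3_def algebra_simps)

text \<open>The entries of \<open>cof3\<close> are the minors for cyclically adjacent rows and
  columns. Every pair of distinct indices is adjacent in one of the two orders, and for equal
  indices the identity is trivial.\<close>

lemma minors_eqI: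
  assumes "\<And>i j. cof3 M i j = 0"
  shows "M a b * M c e = M a e * M c b"
proof -
  have eq: "M (i + 1) (j + 1) * M (i + 2) (j + 2) = M (i + 1) (j + 2) * M (i + 2) (j + 1)" for i j
    using assms[of i j] by (simp add: cof3_def)
  have minor: "M a b * M (a + 1) (b + 1) = M a (b + 1) * M (a + 1) b" for a b
    using eq[of "a + 2" "b + 2"] by (simp add: mult_ac)
  have *: "M a b * M (a + 1) e = M a e * M (a + 1) b" for a b e
    by (cases e b rule: three_cases)
      (use minor[of a b] minor[of a "b + 2"] in \<open>simp_all add: mult_ac\<close>)
  show ?thesis
    by (cases c a rule: three_cases)
      (use *[of a b e] *[of "a + 2" b e] in \<open>simp_all add: mult_ac\<close>)
qed

text \<open>Jacobi's formula for the derivative of a determinant.\<close>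

lemma pderiv_det3:
  fixes M :: "3 \<Rightarrow> 3 \<Rightarrow> 'a::idom poly"
  shows "pderiv (det3 M) = (\<Sum>i\<in>UNIV. \<Sum>j\<in>UNIV. cof3 M i j * pderiv (M i j))"
  unfolding det3_def cof3_def sum_3 pderiv_mult pderiv_add pderiv_diff
  by (simp add: three_numerals algebra_simps)

text \<open>Cramer's rule with a defect: if \<open>M W = 0\<close>, then \<open>W\<close> is
  proportional to row \<open>k\<close> of the cofactor matrix; in general the error is linear in
  \<open>M W\<close>.\<close>

lemma cof3_cramer:
  fixes M :: "3 \<Rightarrow> 3 \<Rightarrow> 'a::comm_ring_1"
  shows "\<exists>N. \<forall>W i. cof3 M k k * W i = W k * cof3 M k i + (\<Sum>p\<in>UNIV. N i p * (\<Sum>j\<in>UNIV. M p j * W j))"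
proof -
  \<comment> \<open>\<open>N\<close> is the adjugate of the 2x2 block left after deleting row and
    column \<open>k\<close>, padded with zeros.\<close>
  define N where "N i p = (if i = k \<or> p = k then 0 else if i = p then M (if i = k + 1 then k + 2 else k + 1) (if i = k + 1 then k + 2 else k + 1) else - M i p)" for i p
  show ?thesis
  proof (intro exI allI)
    fix W i
    show "cof3 M k k * W i = W k * cof3 M k i + (\<Sum>p\<in>UNIV. N i p * (\<Sum>j\<in>UNIV. M p j * W j))"
      by (cases i k rule: three_cases)
        (simp_all add: sum_three[of _ k] N_def cof3_def, simp_all add: algebra_simps)
  qed
qed

section \<open>A uniqueness principle for linear differential systems\<close>

text \<open>Comparing coefficients of \<open>t^m\<close> expresses \<open>b(0) (m + 1)\<close> times
  the coefficient of \<open>u i\<close> at \<open>m + 1\<close> by coefficients of lower index, so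
  all of them vanish by induction.\<close>

lemma polynomial_linear_system_zero:
  fixes u :: "'i::finite \<Rightarrow> 'a::field_char_0 poly"
  assumes ode: "\<And>i. b * pderiv (u i) = (\<Sum>j\<in>UNIV. M i j * u j)"
    and init: "\<And>i. poly (u i) 0 = 0" and b: "poly b 0 \<noteq> 0"
  shows "u i = 0"
proof -
  have "coeff (u i) n = 0" for i n
  proof (induction n arbitrary: i rule: less_induct)
    case (less n)
    show ?case
    proof (cases n)
      case 0
      then show ?thesis using init by (simp add: poly_0_coeff_0)
    next
      case (Suc m)
      have "coeff (b * pderiv (u i)) m = (\<Sum>l\<le>m. coeff b l * coeff (pderiv (u i)) (m - l))"
        by (simp add: coeff_mult)
      \<comment> \<open>For \<open>l > 0\<close> the coefficient of the derivative comes from an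
        index below \<open>n\<close>, where the induction hypothesis applies.\<close>
      also have "\<dots> = (\<Sum>l\<le>m. if l = 0 then coeff b 0 * coeff (pderiv (u i)) m else 0)"
        by (rule sum.cong) (use Suc less in \<open>auto simp: coeff_pderiv\<close>)
      also have "\<dots> = coeff b 0 * (of_nat n * coeff (u i) n)"
        using Suc by (simp add: coeff_pderiv)
      finally have "coeff b 0 * (of_nat n * coeff (u i) n) = 0"
        using less Suc by (simp add: ode coeff_sum coeff_mult)
      then show ?thesis using b Suc by (simp add: poly_0_coeff_0 del: of_nat_Suc)
    qed
  qed
  then show ?thesis by (simp add: poly_eq_iff)
qed

section \<open>Vanishing Hessian\<close>

abbreviation hess :: "('n, 'a::comm_ring_1) mvpoly \<Rightarrow> 'n \<Rightarrow> 'n \<Rightarrow> ('n, 'a) mvpoly" where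
  "hess f i j \<equiv> mv_pderiv i (mv_pderiv j f)"

lemma mv_eval_cof3 [simp]: "mv_eval (cof3 M i j) v = cof3 (\<lambda>i j. mv_eval (M i j) v) i j"
  by (simp add: cof3_def)

lemma mv_eval_det3 [simp]: "mv_eval (det3 M) v = det3 (\<lambda>i j. mv_eval (M i j) v)"
  by (simp add: det3_def)

lemma mv_line_cof3: "mv_line (cof3 M i j) x w = cof3 (\<lambda>i j. mv_line (M i j) x w) i j"
  for M :: "3 \<Rightarrow> 3 \<Rightarrow> ('n::finite, 'a::field_char_0) mvpoly"
  by (simp add: cof3_def mv_line_diff mv_line_mult)

lemma mv_line_det3: "mv_line (det3 M) x w = det3 (\<lambda>i j. mv_line (M i j) x w)"
  for M :: "3 \<Rightarrow> 3 \<Rightarrow> ('n::finite, 'a::field_char_0) mvpoly"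
  by (simp add: det3_def mv_line_sum mv_line_mult mv_line_cof3)

lemma hessian_poly_eq_det3: "hessian_poly f = det3 (hess f)"
  by (simp add: hessian_poly_def det_eq_det3)

lemma hess_commute: "hess f i j = hess f j i"
  by (rule mv_pderiv_commute)

text \<open>Jacobi's formula for \<open>det H = 0\<close>, differentiated along the axis
  \<open>l\<close>.\<close>

lemma sum_cof3_third_derivative:
  fixes f :: "(3, 'a::field_char_0) mvpoly"
  assumes "det3 (hess f) = 0"
  shows "(\<Sum>i\<in>UNIV. \<Sum>j\<in>UNIV. cof3 (hess f) i j * mv_pderiv l (hess f i j)) = 0"
proof (rule mv_eval_eq_0_imp)
  fix v
  have "pderiv (mv_line (det3 (hess f)) v (axis l 1)) = 0"
    by (simp add: assms mv_line_zero)
  then have "poly (\<Sum>i\<in>UNIV. \<Sum>j\<in>UNIV. mv_line (cof3 (hess f) i j) v (axis l 1) *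
      pderiv (mv_line (hess f i j) v (axis l 1))) 0 = 0"
    unfolding mv_line_det3 pderiv_det3 mv_line_cof3 by simp
  then show "mv_eval (\<Sum>i\<in>UNIV. \<Sum>j\<in>UNIV. cof3 (hess f) i j * mv_pderiv l (hess f i j)) v = 0"
    by (simp add: pderiv_mv_line_dirderiv mv_dirderiv_axis poly_sum)
qed

text \<open>Let \<open>u = H w\<close> along the line, and let \<open>C\<close> be the cofactor
  matrix of \<open>H\<close>. By Cramer's rule \<open>w\<close> is, after multiplication by
  \<open>C k k\<close>, a multiple of row \<open>k\<close> of \<open>C\<close> up to terms in
  \<open>u\<close>. The third derivatives contracted twice with that row vanish, so \<open>u\<close>
  solves a linear system with \<open>u(0) = 0\<close>.\<close>

lemma gradient_constant_along_kernel:
  fixes f :: "(3, 'a::field_char_0) mvpoly"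
  assumes hess0: "det3 (hess f) = 0"
    and nz: "mv_eval (cof3 (hess f) k k) x \<noteq> 0"
    and w: "w = (\<chi> i. mv_eval (cof3 (hess f) k i) x)"
  shows "mv_eval (mv_pderiv l f) (x + t *s w) = mv_eval (mv_pderiv l f) x"
proof -
  define H where "H i j = mv_line (hess f i j) x w" for i j
  define T where "T l i j = mv_line (mv_pderiv l (hess f i j)) x w" for l i j
  define C where "C = cof3 H"
  \<comment> \<open>The derivative of the gradient along the line; it has to be shown to
    vanish.\<close>
  define u where "u l = pderiv (mv_line (mv_pderiv l f) x w)" for l
  have C_eq: "C i j = mv_line (cof3 (hess f) i j) x w" for i j
    by (simp add: C_def H_def[abs_def] mv_line_cof3)
  have H_sym: "H i j = H j i" for i j
    by (simp add: H_def hess_commute[of i j])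
  have C_sym: "C i j = C j i" for i j
    unfolding C_def by (rule cof3_symmetric) (rule H_sym)
  have T_sym: "T l i j = T l j i" for l i j
    by (simp add: T_def hess_commute[of i j])
  have det: "det3 H = 0"
    unfolding H_def[abs_def] mv_line_det3[symmetric] hess0 by (simp add: mv_line_zero)
  have C_rank: "C a b * C c e = C a e * C c b" for a b c e
    by (rule minors_eqI) (simp add: C_def cof3_cof3 det)
  have CT: "(\<Sum>i\<in>UNIV. \<Sum>j\<in>UNIV. C i j * T l i j) = 0" for l
    using arg_cong[OF sum_cof3_third_derivative[OF hess0, of l], of "\<lambda>p. mv_line p x w"]
    by (simp add: mv_line_sum mv_line_mult mv_line_zero C_eq T_def)
  have u_eq: "u l = (\<Sum>j\<in>UNIV. H l j * [:w $ j:])" for l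
    unfolding u_def pderiv_mv_line H_def
    by (rule sum.cong) (simp_all add: mv_pderiv_commute[of l])
  have du: "pderiv (u l) = (\<Sum>i\<in>UNIV. \<Sum>j\<in>UNIV. T l i j * [:w $ i:] * [:w $ j:])" for l
    unfolding u_def pderiv_mv_line pderiv_sum_fun pderiv_smult T_def
    by (simp add: smult_sum_right mv_pderiv_commute[of l], subst sum.swap, simp add: mult_ac)
  obtain N where N: "\<And>W i. C k k * W i = W k * C k i + (\<Sum>p\<in>UNIV. N i p * (\<Sum>j\<in>UNIV. H p j * W j))"
    using cof3_cramer[of H k] unfolding C_def by blast
  define W where "W i = [:w $ i:]" for i
  define Y where "Y i = (\<Sum>p\<in>UNIV. N i p * u p)" for i
  have W: "C k k * W i = W k * C k i + Y i" for i
    using N[of W i] by (simp add: Y_def u_eq W_def)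
  have Y: "q * Y j = (\<Sum>p\<in>UNIV. q * N j p * u p)" for q j
    by (simp add: Y_def sum_distrib_left mult.assoc)
  have CCT: "(\<Sum>i\<in>UNIV. \<Sum>j\<in>UNIV. T l i j * (C k i * C k j)) = 0" for l
  proof -
    \<comment> \<open>Rank one of \<open>C\<close> reduces the double contraction with row
      \<open>k\<close> to the contraction \<open>CT\<close> with \<open>C\<close> itself.\<close>
    have "C k i * C k j = C k k * C i j" for i j
      using C_rank[of k i j k] by (simp add: C_sym mult_ac)
    then have "(\<Sum>i\<in>UNIV. \<Sum>j\<in>UNIV. T l i j * (C k i * C k j)) =
        C k k * (\<Sum>i\<in>UNIV. \<Sum>j\<in>UNIV. C i j * T l i j)"
      by (simp add: sum_distrib_left mult_ac)
    then show ?thesis by (simp add: CT)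
  qed
  \<comment> \<open>The right-hand side is quadratic in \<open>u\<close>, but the factor
    \<open>Y i\<close> may be absorbed into the coefficients as a given polynomial, which leaves a
    system linear in \<open>u\<close>.\<close>
  have ode: "C k k ^ 2 * pderiv (u l) =
    (\<Sum>p\<in>UNIV. (\<Sum>i\<in>UNIV. \<Sum>j\<in>UNIV. T l i j * (2 * W k * C k i + Y i) * N j p) * u p)" for l
  proof -
    have "C k k ^ 2 * pderiv (u l) = (\<Sum>i\<in>UNIV. \<Sum>j\<in>UNIV. T l i j * ((C k k * W i) * (C k k * W j)))"
      by (simp add: du W_def[symmetric] sum_distrib_left power2_eq_square mult_ac)
    also have "\<dots> = W k ^ 2 * (\<Sum>i\<in>UNIV. \<Sum>j\<in>UNIV. T l i j * (C k i * C k j)) +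
      (\<Sum>i\<in>UNIV. \<Sum>j\<in>UNIV. T l i j * (2 * W k * C k i + Y i) * Y j)"
    proof -
      \<comment> \<open>The two mixed terms agree by symmetry of \<open>T\<close>, whence the factor
        2.\<close>
      have "(\<Sum>i\<in>UNIV. \<Sum>j\<in>UNIV. T l i j * (Y i * C k j)) = (\<Sum>i\<in>UNIV. \<Sum>j\<in>UNIV. T l i j * (C k i * Y j))"
        by (subst sum.swap) (simp add: T_sym mult_ac)
      then have "(\<Sum>i\<in>UNIV. \<Sum>j\<in>UNIV. W k * (T l i j * (Y i * C k j))) =
          (\<Sum>i\<in>UNIV. \<Sum>j\<in>UNIV. W k * (T l i j * (C k i * Y j)))"
        by (simp only: sum_distrib_left[symmetric])
      then show ?thesis
        unfolding W by (simp add: algebra_simps power2_eq_square sum.distrib sum_distrib_left)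
    qed
    also have "\<dots> = (\<Sum>i\<in>UNIV. \<Sum>j\<in>UNIV. T l i j * (2 * W k * C k i + Y i) * Y j)"
      by (simp add: CCT)
    also have "\<dots> = (\<Sum>i\<in>UNIV. \<Sum>j\<in>UNIV. \<Sum>p\<in>UNIV. T l i j * (2 * W k * C k i + Y i) * N j p * u p)"
      by (simp only: Y)
    also have "\<dots> = (\<Sum>p\<in>UNIV. \<Sum>i\<in>UNIV. \<Sum>j\<in>UNIV. T l i j * (2 * W k * C k i + Y i) * N j p * u p)"
      by (subst sum.swap, subst (2) sum.swap) simp
    finally show ?thesis by (simp add: sum_distrib_right)
  qed
  have "u l = 0" for l
  proof (rule polynomial_linear_system_zero[OF ode])
    show "poly (C k k ^ 2) 0 \<noteq> 0"
      using nz by (simp add: C_eq)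
    show "poly (u i) 0 = 0" for i
    proof -
      \<comment> \<open>At \<open>t = 0\<close> the vector \<open>w\<close> is a cofactor row of the
        singular matrix \<open>H(x)\<close>, hence in its kernel.\<close>
      have "poly (u i) 0 = (\<Sum>j\<in>UNIV. mv_eval (hess f i j) x * cof3 (\<lambda>i j. mv_eval (hess f i j) x) k j)"
        by (simp add: u_eq poly_sum H_def w mult.commute)
      also have "\<dots> = 0"
        using arg_cong[OF hess0, of "\<lambda>p. mv_eval p x"] by (simp add: row_times_cof3[of "\<lambda>i j. mv_eval (hess f i j) x"])
      finally show ?thesis .
    qed
  qed
  then have "pderiv (mv_line (mv_pderiv l f) x w) = 0"
    by (simp add: u_def)
  then obtain h where "mv_line (mv_pderiv l f) x w = [:h:]"
    using pderiv_iszero by blast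
  then have "poly (mv_line (mv_pderiv l f) x w) t = poly (mv_line (mv_pderiv l f) x w) 0" by simp
  then show "mv_eval (mv_pderiv l f) (x + t *s w) = mv_eval (mv_pderiv l f) x" by simp
qed

text \<open>Homogeneity extends constancy along \<open>x + t w\<close> to the plane. The case
  \<open>s = 0\<close>, obtained by polynomial continuation, makes the gradient vanish along
  \<open>w\<close> when \<open>d \<ge> 2\<close>.\<close>

lemma gradient_on_kernel_plane:
  fixes f :: "(3, 'a::field_char_0) mvpoly"
  assumes "det3 (hess f) = 0" "mv_eval (cof3 (hess f) k k) x \<noteq> 0"
    and "w = (\<chi> i. mv_eval (cof3 (hess f) k i) x)"
    and hom: "mv_homogeneous d f"
  shows "mv_eval (mv_pderiv l f) (s *s x + t *s w) = s ^ (d - 1) * mv_eval (mv_pderiv l f) x"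
proof -
  let ?g = "mv_pderiv l f"
  have scale: "mv_eval ?g (c *s v) = c ^ (d - 1) * mv_eval ?g v" for c v
    by (intro mv_eval_homogeneous mv_homogeneous_pderiv hom)
  have *: "mv_eval ?g (s *s x + t *s w) = s ^ (d - 1) * mv_eval ?g x" if "s \<noteq> 0" for s
  proof -
    have "s *s x + t *s w = s *s (x + (t / s) *s w)"
      using that by (simp add: vec_eq_iff algebra_simps)
    then show ?thesis
      using gradient_constant_along_kernel[OF assms(1-3), of l "t / s"] by (simp only: scale)
  qed
  \<comment> \<open>The identity is known for \<open>s \<noteq> 0\<close> only; the factor
    \<open>[:0, 1:]\<close> makes it hold at 0 as well and is then cancelled.\<close>
  have "[:0, 1:] * (mv_line ?g (t *s w) x - monom (mv_eval ?g x) (d - 1)) = 0"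
    by (rule poly_ext_char_0) (use * in \<open>auto simp: poly_monom add.commute mult.commute\<close>)
  then have "mv_line ?g (t *s w) x = monom (mv_eval ?g x) (d - 1)"
    by simp
  then have "poly (mv_line ?g (t *s w) x) s = s ^ (d - 1) * mv_eval ?g x"
    by (simp only: poly_monom mult.commute)
  then show ?thesis by (simp add: add.commute)
qed

text \<open>The determinant with rows \<open>a\<close>, \<open>b\<close>, \<open>c\<close>.\<close>

definition triple :: "'a::comm_ring_1^3 \<Rightarrow> 'a^3 \<Rightarrow> 'a^3 \<Rightarrow> 'a" where
  "triple a b c = a $ 1 * (b $ 2 * c $ 3 - b $ 3 * c $ 2) + a $ 2 * (b $ 3 * c $ 1 - b $ 1 * c $ 3)
     + a $ 3 * (b $ 1 * c $ 2 - b $ 2 * c $ 1)"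

text \<open>Cramer's rule as a linear relation between four vectors in dimension 3; it yields
  explicit common vectors of planes.\<close>

lemma triple_cramer:
  "triple b c e *s a - triple a c e *s b + triple a b e *s c - triple a b c *s e = 0"
  by (simp add: vec_eq_iff forall_3 triple_def algebra_simps)

text \<open>The hypothesis lists the entries of the cross product of \<open>v\<close> and
  \<open>w\<close>.\<close>

lemma triple_axis_eq_0_imp:
  assumes "\<And>m. triple v w (axis m 1) = 0"
  shows "v $ i * w $ j = v $ j * w $ i"
  using assms[of 1] assms[of 2] assms[of 3] exhaust_3[of i] exhaust_3[of j]
  by (auto simp: triple_def axis_def algebra_simps)

text \<open>If \<open>w\<close> and \<open>z\<close> are independent, the planes spanned by
  \<open>x\<close>, \<open>w\<close> and by \<open>y\<close>, \<open>z\<close> share a vector. The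
  gradient there is a multiple both of the gradient at \<open>x\<close> and of that at
  \<open>y\<close>.\<close>

lemma kernels_or_gradients_parallel:
  fixes f :: "(3, 'a::field_char_0) mvpoly"
  assumes d: "d \<ge> 2" and hom: "mv_homogeneous d f" and hess0: "det3 (hess f) = 0"
    and x: "mv_eval (cof3 (hess f) k k) x \<noteq> 0" and w: "w = (\<chi> i. mv_eval (cof3 (hess f) k i) x)"
    and y: "mv_eval (cof3 (hess f) k k) y \<noteq> 0" and z: "z = (\<chi> i. mv_eval (cof3 (hess f) k i) y)"
  shows "(\<forall>i j. w $ i * z $ j = w $ j * z $ i) \<or>
    (\<forall>i j. mv_eval (mv_pderiv i f) y * mv_eval (mv_pderiv j f) x =
           mv_eval (mv_pderiv j f) y * mv_eval (mv_pderiv i f) x)"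
proof (intro disj_imp[THEN iffD2] impI)
  assume "\<not> (\<forall>i j. w $ i * z $ j = w $ j * z $ i)"
  then obtain m where m: "triple w z (axis m 1) \<noteq> 0"
    using triple_axis_eq_0_imp by blast
  define e :: "'a^3" where "e = axis m 1"
  define g where "g l v = mv_eval (mv_pderiv l f) v" for l v
  note gx = gradient_on_kernel_plane[OF hess0 x w hom, folded g_def]
  note gy = gradient_on_kernel_plane[OF hess0 y z hom, folded g_def]
  have gw0: "g l (t *s w) = 0" and gz0: "g l (t *s z) = 0" for l t
    using gx[of l 0 t] gy[of l 0 t] d by simp_all
  \<comment> \<open>Here \<open>x\<close> lies in the span of \<open>w\<close> and \<open>z\<close>,
    so the plane through \<open>x\<close> and \<open>w\<close> contains \<open>z\<close>, where the
    gradient vanishes; but there it is also a nonzero multiple of the gradient at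
    \<open>x\<close>.\<close>
  have x0: "g l x = 0" if "triple x w z = 0" for l
  proof -
    have h: "triple w z e *s x + (- triple x z e) *s w = (- triple x w e) *s z"
      using triple_cramer[of w z e x] that by (simp add: vec_eq_iff algebra_simps)
    have "triple w z e ^ (d - 1) * g l x = 0"
      using gx[of l "triple w z e" "- triple x z e", unfolded h gz0] by simp
    then show ?thesis using m by (simp add: e_def)
  qed
  have y0: "g l y = 0" if "triple y w z = 0" for l
  proof -
    have h: "triple w z e *s y + triple y w e *s z = triple y z e *s w"
      using triple_cramer[of w z e y] that by (simp add: vec_eq_iff algebra_simps)
    have "triple w z e ^ (d - 1) * g l y = 0"
      using gy[of l "triple w z e" "triple y w e", unfolded h gw0] by simp
    then show ?thesis using m by (simp add: e_def)
  qed
  show "\<forall>i j. mv_eval (mv_pderiv i f) y * mv_eval (mv_pderiv j f) x =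
           mv_eval (mv_pderiv j f) y * mv_eval (mv_pderiv i f) x"
  proof (cases "triple x w z = 0 \<or> triple y w z = 0")
    case True
    then show ?thesis using x0 y0 by (auto simp: g_def)
  next
    case False
    \<comment> \<open>The common vector of the two planes; its coefficients at \<open>x\<close> and
      \<open>y\<close> are nonzero in this case.\<close>
    have h: "triple w y z *s x + (- triple x y z) *s w = (- triple x w z) *s y + triple x w y *s z"
      using triple_cramer[of w y z x] by (simp add: vec_eq_iff algebra_simps)
    have eq: "triple w y z ^ (d - 1) * g l x = (- triple x w z) ^ (d - 1) * g l y" for l
      using gx[of l "triple w y z" "- triple x y z", unfolded h gy] by (rule sym)
    have "triple w y z \<noteq> 0"
      using False by (auto simp: triple_def algebra_simps)
    then have "g l x = (- triple x w z) ^ (d - 1) / triple w y z ^ (d - 1) * g l y" for l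
      using eq[of l] by (simp add: field_simps)
    then show ?thesis by (simp add: g_def)
  qed
qed

section \<open>The cases of generic rank two and of rank at most one\<close>

lemma of_nat_minus_1_neq_0: "d \<ge> 2 \<Longrightarrow> of_nat d - 1 \<noteq> (0 :: 'a::ring_char_0)"
  by auto

lemma euler_gradient:
  fixes f :: "('n::finite, 'a::field_char_0) mvpoly"
  assumes "mv_homogeneous d f" "d \<ge> 1"
  shows "(\<Sum>j\<in>UNIV. v $ j * mv_eval (hess f i j) v) = (of_nat d - 1) * mv_eval (mv_pderiv i f) v"
  using mv_euler[OF mv_homogeneous_pderiv[OF assms(1), of i], of v] assms(2)
  by (simp add: of_nat_diff mv_pderiv_commute[of i])

text \<open>Euler's identity gives \<open>(d - 1)\<close> times the gradient as \<open>H v\<close>;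
  pairing with \<open>w\<close> and using the symmetry of \<open>H\<close> leaves
  \<open>H w = 0\<close>.\<close>

lemma dirderiv_kernel_eq_0:
  fixes f :: "('n::finite, 'a::field_char_0) mvpoly"
  assumes hom: "mv_homogeneous d f" "d \<ge> 2"
    and w: "\<And>i. (\<Sum>j\<in>UNIV. mv_eval (hess f i j) v * w $ j) = 0"
  shows "(\<Sum>i\<in>UNIV. w $ i * mv_eval (mv_pderiv i f) v) = 0"
proof -
  have "(of_nat d - 1) * (\<Sum>i\<in>UNIV. w $ i * mv_eval (mv_pderiv i f) v) =
    (\<Sum>i\<in>UNIV. w $ i * (\<Sum>j\<in>UNIV. v $ j * mv_eval (hess f i j) v))"
    using hom by (simp add: euler_gradient sum_distrib_left mult_ac)
  also have "\<dots> = (\<Sum>j\<in>UNIV. v $ j * (\<Sum>i\<in>UNIV. mv_eval (hess f j i) v * w $ i))"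
    by (simp add: sum_distrib_left, subst sum.swap)
      (simp add: mult_ac mv_pderiv_commute)
  also have "\<dots> = 0" by (simp add: w)
  finally show ?thesis using hom(2)
    by (simp add: of_nat_minus_1_neq_0)
qed

lemma vanishing_hessian_rank_two:
  fixes f :: "(3, 'a::field_char_0) mvpoly"
  assumes d: "d \<ge> 2" and hom: "mv_homogeneous d f" and hess0: "det3 (hess f) = 0"
    and f0: "f \<noteq> 0" and k: "cof3 (hess f) k k \<noteq> 0"
  shows "\<exists>b. b \<noteq> 0 \<and> mv_dirderiv b f = 0"
proof -
  let ?C = "cof3 (hess f)"
  \<comment> \<open>The first condition makes the kernel vector \<open>w\<close> nonzero, the second
    the gradient \<open>g\<close>.\<close>
  obtain x where x: "mv_eval (?C k k) x \<noteq> 0" "mv_eval f x \<noteq> 0"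
    using mv_eval_product_eq_0[of "?C k k" f] f0 k by auto
  define w where "w = (\<chi> i. mv_eval (?C k i) x)"
  define g where "g i = mv_eval (mv_pderiv i f) x" for i
  \<comment> \<open>All \<open>P i j\<close> vanish at a point exactly if the gradient there is
    proportional to \<open>g\<close>.\<close>
  define P where "P i j = mv_const (g j) * mv_pderiv i f - mv_const (g i) * mv_pderiv j f" for i j
  \<comment> \<open>Where neither factor of the first product vanishes, the gradients at
    \<open>x\<close> and \<open>y\<close> are not parallel, so the kernels are, and \<open>w\<close>
    is orthogonal to the gradient at \<open>y\<close>.\<close>
  have "mv_eval (?C k k * P i j) y * mv_eval (mv_dirderiv w f) y = 0" for i j y
  proof (cases "mv_eval (?C k k) y = 0 \<or> mv_eval (P i j) y = 0")
    case False
    define z where "z = (\<chi> i. mv_eval (?C k i) y)"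
    have zk: "z $ k \<noteq> 0" using False by (simp add: z_def)
    have "mv_eval (P i j) y \<noteq> 0" using False by simp
    then have wz: "w $ i * z $ j = w $ j * z $ i" for i j
      using kernels_or_gradients_parallel[OF d hom hess0 x(1) w_def _ z_def] False
      by (auto simp: P_def g_def mult.commute)
    have w_eq: "w $ i = w $ k / z $ k * z $ i" for i
      using zk wz[of i k] by (simp add: field_simps)
    have "(\<Sum>i\<in>UNIV. z $ i * mv_eval (mv_pderiv i f) y) = 0"
    proof (rule dirderiv_kernel_eq_0[OF hom d])
      fix i
      have "(\<Sum>j\<in>UNIV. hess f i j * ?C k j) = 0"
        by (simp add: row_times_cof3[of "hess f"] hess0)
      from arg_cong[OF this, of "\<lambda>p. mv_eval p y"]
      show "(\<Sum>j\<in>UNIV. mv_eval (hess f i j) y * z $ j) = 0"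
        by (simp add: z_def)
    qed
    moreover have "mv_eval (mv_dirderiv w f) y =
      w $ k / z $ k * (\<Sum>i\<in>UNIV. z $ i * mv_eval (mv_pderiv i f) y)"
      unfolding mv_eval_dirderiv by (subst w_eq) (simp add: sum_distrib_left mult_ac)
    ultimately show ?thesis by simp
  qed auto
  then have "?C k k * P i j = 0 \<or> mv_dirderiv w f = 0" for i j
    by (rule mv_eval_product_eq_0)
  then have PQ: "P i j = 0 \<or> mv_dirderiv w f = 0" for i j
    using mv_eval_product_eq_0[of "?C k k" "P i j"] k by (metis mv_eval_mult mv_eval_zero)
  show ?thesis
  proof (cases "mv_dirderiv w f = 0")
    case True
    moreover have "w \<noteq> 0"
      using x by (auto simp: w_def vec_eq_iff)
    ultimately show ?thesis by blast
  next
    case False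
    then have P0: "P i j = 0" for i j using PQ by blast
    have "\<exists>j. g j \<noteq> 0"
    proof (rule ccontr)
      assume "\<nexists>j. g j \<noteq> 0"
      then have "of_nat d * mv_eval f x = 0"
        unfolding mv_euler[OF hom, symmetric] by (simp add: g_def)
      with x d show False by simp
    qed
    then obtain j where j: "g j \<noteq> 0" by blast
    \<comment> \<open>A vector orthogonal to \<open>g\<close>, hence to every gradient.\<close>
    define b :: "'a^3" where "b = axis (j + 1) (g j) - axis j (g (j + 1))"
    have "mv_eval (mv_dirderiv b f) v = mv_eval (P (j + 1) j) v" for v
      by (simp add: mv_eval_dirderiv P_def b_def axis_def sum_three[of _ j])
    then have "mv_dirderiv b f = 0"
      by (intro mv_eval_eq_0_imp) (simp add: P0)
    moreover have "b $ (j + 1) \<noteq> 0"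
      using j by (simp add: b_def axis_def)
    ultimately show ?thesis by (metis zero_index)
  qed
qed

lemma exists_orthogonal3:
  fixes g :: "3 \<Rightarrow> 'a::field"
  shows "\<exists>b::'a^3. b \<noteq> 0 \<and> (\<Sum>i\<in>UNIV. b $ i * g i) = 0"
proof (cases "g 1 = 0")
  case True
  then have "axis 1 1 \<noteq> (0::'a^3)" "(\<Sum>i\<in>UNIV. (axis 1 1 :: 'a^3) $ i * g i) = 0"
    by (simp add: axis_eq_0_iff, simp add: axis_def sum_3)
  then show ?thesis by blast
next
  case False
  define b :: "'a^3" where "b = axis 2 (g 1) - axis 1 (g 2)"
  have "b $ 2 \<noteq> 0" "(\<Sum>i\<in>UNIV. b $ i * g i) = 0"
    using False by (simp_all add: b_def axis_def sum_3)
  then show ?thesis by (metis zero_index)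
qed

text \<open>For \<open>b\<close> orthogonal to the gradient at \<open>x\<close>, the function
  \<open>u = D\<^sub>b f\<close> satisfies \<open>d f u' = (d - 1) (D\<^sub>y f) u\<close> along
  \<open>x + t y\<close>. As \<open>u(0) = 0\<close> and \<open>f(x) \<noteq> 0\<close>, it vanishes
  on every line through \<open>x\<close>.\<close>

lemma vanishing_hessian_rank_one:
  fixes f :: "(3, 'a::field_char_0) mvpoly"
  assumes d: "d \<ge> 2" and hom: "mv_homogeneous d f" and hess0: "det3 (hess f) = 0"
    and f0: "f \<noteq> 0" and C0: "\<And>k. cof3 (hess f) k k = 0"
  shows "\<exists>b. b \<noteq> 0 \<and> mv_dirderiv b f = 0"
proof -
  have minors: "mv_eval (hess f a b) v * mv_eval (hess f c e) v =
      mv_eval (hess f a e) v * mv_eval (hess f c b) v" for a b c e v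
  proof (rule minors_eqI[of "\<lambda>i j. mv_eval (hess f i j) v"])
    fix i j
    let ?H = "\<lambda>i j. mv_eval (hess f i j) v"
    have sym: "cof3 ?H i j = cof3 ?H j i"
      by (rule cof3_symmetric) (simp add: mv_pderiv_commute)
    have "det3 ?H = 0" and diag: "cof3 ?H i i = 0" for i
      using arg_cong[OF hess0, of "\<lambda>p. mv_eval p v"] arg_cong[OF C0[of i], of "\<lambda>p. mv_eval p v"]
      by simp_all
    \<comment> \<open>The symmetric cofactor matrix has rank at most one, so the square of each
      entry is a product of diagonal entries, which are zero.\<close>
    then have "cof3 ?H i i * cof3 ?H j j = cof3 ?H i j * cof3 ?H j i"
      by (intro minors_eqI) (simp add: cof3_cof3)
    then show "cof3 ?H i j = 0" by (simp add: diag sym)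
  qed
  have rank1: "of_nat d * mv_eval f v * mv_eval (hess f i j) v =
      (of_nat d - 1) * mv_eval (mv_pderiv i f) v * mv_eval (mv_pderiv j f) v" for i j v
  proof -
    let ?H = "\<lambda>i j. mv_eval (hess f i j) v"
    define c :: 'a where "c = of_nat d - 1"
    have c: "c \<noteq> 0"
      using d by (simp add: c_def of_nat_minus_1_neq_0)
    have euler: "(\<Sum>j\<in>UNIV. v $ j * ?H i j) = c * mv_eval (mv_pderiv i f) v" for i
      using euler_gradient[OF hom, of v i] d by (simp add: c_def)
    have minor: "?H i j * ?H p q = ?H i q * ?H j p" for p q
      using minors[of i j v p q] by (simp only: mv_pderiv_commute[of p j])
    \<comment> \<open>Euler's identity, applied to \<open>f\<close> and to its gradient, gives
      \<open>d (d - 1) f\<close> as the quadratic form of \<open>H\<close> at \<open>v\<close>; the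
      minors then split it into two factors.\<close>
    have "c * (of_nat d * mv_eval f v) * ?H i j = (\<Sum>p\<in>UNIV. v $ p * (\<Sum>q\<in>UNIV. v $ q * ?H p q)) * ?H i j"
      by (simp add: euler mv_euler[OF hom, symmetric] sum_distrib_left mult_ac)
    also have "\<dots> = (\<Sum>p\<in>UNIV. \<Sum>q\<in>UNIV. v $ p * v $ q * (?H i j * ?H p q))"
      by (simp add: sum_distrib_left sum_distrib_right mult_ac)
    also have "\<dots> = (\<Sum>p\<in>UNIV. \<Sum>q\<in>UNIV. v $ p * v $ q * (?H i q * ?H j p))"
      by (simp only: minor)
    also have "\<dots> = (\<Sum>q\<in>UNIV. v $ q * ?H i q) * (\<Sum>p\<in>UNIV. v $ p * ?H j p)"
      by (simp only: sum_product) (subst sum.swap, simp add: mult_ac)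
    finally have "c * (of_nat d * mv_eval f v * ?H i j) =
        c * (c * mv_eval (mv_pderiv i f) v * mv_eval (mv_pderiv j f) v)"
      by (simp add: euler mult_ac)
    then show ?thesis using c by (simp add: c_def)
  qed
  obtain x where x: "mv_eval f x \<noteq> 0"
    using f0 mv_eval_eq_0_imp by blast
  obtain b :: "'a^3" where b: "b \<noteq> 0" "(\<Sum>i\<in>UNIV. b $ i * mv_eval (mv_pderiv i f) x) = 0"
    using exists_orthogonal3[of "\<lambda>i. mv_eval (mv_pderiv i f) x"] by blast
  have "mv_eval (mv_dirderiv b f) (x + y) = 0" for y
  proof -
    define F where "F = mv_line f x y"
    define G where "G i = mv_line (mv_pderiv i f) x y" for i
    define H where "H i j = mv_line (hess f i j) x y" for i j
    define u where "u = mv_line (mv_dirderiv b f) x y"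
    have FH: "[:of_nat d:] * F * H i j = [:of_nat d - 1:] * G i * G j" for i j
      by (rule poly_ext_char_0) (simp add: F_def G_def H_def rank1[unfolded mult.assoc] mult.assoc)
    have u: "u = (\<Sum>i\<in>UNIV. [:b $ i:] * G i)"
      unfolding u_def mv_dirderiv_def mv_line_sum mv_line_mult mv_line_const G_def ..
    have "pderiv u = (\<Sum>i\<in>UNIV. [:b $ i:] * (\<Sum>j\<in>UNIV. [:y $ j:] * H j i))"
      by (simp add: u pderiv_sum_fun pderiv_smult G_def pderiv_mv_line H_def)
    then have "[:of_nat d:] * F * pderiv u =
      (\<Sum>i\<in>UNIV. [:b $ i:] * (\<Sum>j\<in>UNIV. [:y $ j:] * ([:of_nat d:] * F * H j i)))"
      by (simp only: sum_distrib_left) (simp only: mult_ac)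
    also have "\<dots> = ([:of_nat d - 1:] * (\<Sum>j\<in>UNIV. [:y $ j:] * G j)) * u"
      unfolding FH u sum_product sum_distrib_left sum_distrib_right
      by (simp only: mult_ac)
    finally have ode: "[:of_nat d:] * F * pderiv u = ([:of_nat d - 1:] * (\<Sum>j\<in>UNIV. [:y $ j:] * G j)) * u" .
    \<comment> \<open>A single equation is a system indexed by \<open>unit\<close>.\<close>
    have "(\<lambda>_::unit. u) () = 0"
    proof (rule polynomial_linear_system_zero)
      show "[:of_nat d:] * F * pderiv u =
        (\<Sum>j\<in>(UNIV :: unit set). ([:of_nat d - 1:] * (\<Sum>j\<in>UNIV. [:y $ j:] * G j)) * u)"
        using ode by (simp add: UNIV_unit)
      show "poly u 0 = 0"
        using b by (simp add: u_def mv_eval_dirderiv)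
      show "poly ([:of_nat d:] * F) 0 \<noteq> 0"
        using x d by (simp add: F_def)
    qed
    then have "poly u 1 = 0" by simp
    then show ?thesis by (simp add: u_def)
  qed
  then have "mv_eval (mv_dirderiv b f) (x + (v - x)) = 0" for v
    by blast
  then have "mv_dirderiv b f = 0"
    by (intro mv_eval_eq_0_imp) simp
  with b show ?thesis by blast
qed

text \<open>The forward direction distinguishes whether all principal 2x2 minors vanish. Conversely,
  differentiating \<open>D\<^sub>b f = 0\<close> along each axis puts \<open>b\<close> into the
  kernel of the Hessian matrix.\<close>

theorem hessian_poly_eq_0_iff_is_cone:
  fixes f :: "(3, 'a::field_char_0) mvpoly"
  assumes d: "d \<ge> 2" and hom: "mv_homogeneous d f" and f0: "f \<noteq> 0"
  shows "hessian_poly f = 0 \<longleftrightarrow> is_cone f"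
  unfolding is_cone_iff_dirderiv hessian_poly_eq_det3
proof
  assume "det3 (hess f) = 0"
  then show "\<exists>b. b \<noteq> 0 \<and> mv_dirderiv b f = 0"
    by (cases "\<forall>k. cof3 (hess f) k k = 0")
      (simp add: vanishing_hessian_rank_one[OF d hom _ f0],
        metis vanishing_hessian_rank_two[OF d hom _ f0])
next
  assume "\<exists>b. b \<noteq> 0 \<and> mv_dirderiv b f = 0"
  then obtain b where b: "b \<noteq> 0" "mv_dirderiv b f = 0" by blast
  show "det3 (hess f) = 0"
  proof (rule mv_eval_eq_0_imp)
    fix v
    let ?A = "\<chi> i j. mv_eval (hess f i j) v"
    have "?A *v b = 0"
    proof -
      have "(\<Sum>j\<in>UNIV. mv_eval (hess f i j) v * b $ j) = 0" for i
      proof -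
        have "(\<Sum>j\<in>UNIV. smult (b $ j) (mv_line (mv_pderiv j f) v (axis i 1))) = 0"
          using arg_cong[OF b(2), of "\<lambda>p. mv_line p v (axis i 1)"]
          by (simp add: mv_dirderiv_def mv_line_sum mv_line_mult mv_line_const mv_line_zero)
        from arg_cong[OF this, of "\<lambda>p. poly (pderiv p) 0"]
        show ?thesis
          by (simp add: pderiv_sum_fun pderiv_smult poly_sum pderiv_mv_line_dirderiv mv_dirderiv_axis mult_ac)
      qed
      then show ?thesis by (simp add: matrix_vector_mult_def vec_eq_iff)
    qed
    then have "\<not> invertible ?A"
      using b(1) by (metis invertible_left_inverse matrix_left_invertible_ker)
    then have "det ?A = 0" by (simp add: invertible_det_nz)
    then show "mv_eval (det3 (hess f)) v = 0" by (simp add: det_eq_det3)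
  qed
qed

section \<open>Concurrent lines\<close>

lemma mv_eval_zero_vec:
  assumes "mv_homogeneous d f" "d \<ge> 1"
  shows "mv_eval f 0 = 0"
  using mv_eval_homogeneous[OF assms(1), of 0 0] assms(2) by (simp add: power_0_left)

lemma proj_point_mem_proj_zeros_iff:
  fixes f :: "('n::finite, 'a::field) mvpoly"
  assumes "mv_homogeneous d f" "v \<noteq> 0"
  shows "proj_point v \<in> proj_zeros f \<longleftrightarrow> mv_eval f v = 0"
proof -
  have "v \<in> proj_point v"
    unfolding proj_point_def by (auto intro!: exI[of _ 1])
  then show ?thesis
    using assms(2)
    by (auto simp: proj_zeros_def proj_space_def proj_point_def mv_eval_homogeneous[OF assms(1)])
qed

text \<open>The partial derivatives have degree 0 and are constant, by scaling with 0 and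
  \<open>0 ^ 0 = 1\<close>; Euler's identity then shows that \<open>l\<close> is linear.\<close>

lemma mv_eval_homogeneous_1:
  fixes l :: "('n::finite, 'a::field_char_0) mvpoly"
  assumes "mv_homogeneous 1 l"
  shows "mv_eval l (x + t *s y) = mv_eval l x + t * mv_eval l y"
proof -
  have const: "mv_eval (mv_pderiv i l) v = mv_eval (mv_pderiv i l) 0" for i v
    using mv_eval_homogeneous[OF mv_homogeneous_pderiv[OF assms, of i], of 0 v] by simp
  have "mv_eval l v = (\<Sum>i\<in>UNIV. v $ i * mv_eval (mv_pderiv i l) 0)" for v
    using mv_euler[OF assms, of v] unfolding const[of _ v] by simp
  then show ?thesis
    by (simp add: algebra_simps sum.distrib sum_distrib_left)
qed

lemma mv_homogeneous_linear_form:
  "mv_homogeneous 1 (\<Sum>i\<in>UNIV. mv_const (c i) * mv_var i :: ('n::finite, 'a::comm_ring_1) mvpoly)"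
  unfolding mv_homogeneous_def
proof
  fix m assume "m \<in> Poly_Mapping.keys (\<Sum>i\<in>UNIV. mv_const (c i) * mv_var i)"
  then have "(\<Sum>i\<in>UNIV. Poly_Mapping.lookup (Poly_Mapping.single (Poly_Mapping.single i (1::nat)) (c i)) m) \<noteq> 0"
    by (simp add: in_keys_iff lookup_sum mv_const_def mv_var_def mult_single)
  then obtain i where "Poly_Mapping.lookup (Poly_Mapping.single (Poly_Mapping.single i (1::nat)) (c i)) m \<noteq> 0"
    by (meson sum.neutral)
  then have "m = Poly_Mapping.single i 1"
    by (auto simp: lookup_single when_def split: if_splits)
  then show "(\<Sum>i\<in>UNIV. Poly_Mapping.lookup m i) = 1"
    by (simp add: lookup_single when_def)
qed

section \<open>Degree and top coefficient of a restriction to a line\<close>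

lemma coeff_mult_bounds:
  assumes "degree p \<le> m" "degree q \<le> n"
  shows "coeff (p * q) (m + n) = coeff p m * coeff q n"
proof -
  have "coeff (p * q) (m + n) = (\<Sum>i\<le>m + n. if i = m then coeff p m * coeff q n else 0)"
    unfolding coeff_mult
  proof (rule sum.cong)
    fix i assume "i \<in> {..m + n}"
    consider "i < m" | "i = m" | "i > m" by linarith
    then show "coeff p i * coeff q (m + n - i) = (if i = m then coeff p m * coeff q n else 0)"
      by cases (use assms in \<open>auto simp: coeff_eq_0\<close>)
  qed simp
  then show ?thesis by simp
qed

lemma degree_coeff_linear_power:
  "degree ([:a, b:] ^ n) \<le> n \<and> coeff ([:a, b:] ^ n) n = (b :: 'a::comm_ring_1) ^ n"
proof (induction n)
  case (Suc n)
  have d1: "degree [:a, b:] \<le> 1" by simp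
  show ?case
    using coeff_mult_bounds[OF d1, of "[:a, b:] ^ n" n] degree_mult_le[of "[:a, b:]" "[:a, b:] ^ n"] Suc d1
    by (simp del: degree_pCons_eq_if)
qed simp

lemma degree_coeff_linear_prod:
  fixes a b :: "'i \<Rightarrow> 'a::comm_ring_1"
  assumes "finite S"
  shows "degree (\<Prod>i\<in>S. [:a i, b i:] ^ n i) \<le> (\<Sum>i\<in>S. n i) \<and>
    coeff (\<Prod>i\<in>S. [:a i, b i:] ^ n i) (\<Sum>i\<in>S. n i) = (\<Prod>i\<in>S. b i ^ n i)"
  using assms
proof (induction S)
  case (insert i S)
  let ?p = "[:a i, b i:] ^ n i" and ?q = "\<Prod>i\<in>S. [:a i, b i:] ^ n i"
  show ?case
    using insert degree_coeff_linear_power[of "a i" "b i" "n i"] degree_mult_le[of ?p ?q]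
      coeff_mult_bounds[of ?p "n i" ?q "sum n S"]
    by simp
qed simp

text \<open>If \<open>f\<close> is nonzero at \<open>w\<close>, the restriction has degree exactly
  \<open>d\<close>, and so \<open>d\<close> roots over an algebraically closed field.\<close>

lemma mv_line_homogeneous:
  assumes "mv_homogeneous d f"
  shows "degree (mv_line f x w) \<le> d" and "coeff (mv_line f x w) d = mv_eval f w"
proof -
  let ?p = "\<lambda>m. \<Prod>i\<in>UNIV. [:x $ i, w $ i:] ^ Poly_Mapping.lookup m i"
  have p: "degree (?p m) \<le> d" "coeff (?p m) d = (\<Prod>i\<in>UNIV. (w $ i) ^ Poly_Mapping.lookup m i)"
    if "m \<in> Poly_Mapping.keys f" for m
    using degree_coeff_linear_prod[of UNIV "\<lambda>i. x $ i" "\<lambda>i. w $ i" "Poly_Mapping.lookup m"] assms that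
    unfolding mv_homogeneous_def by auto
  show "degree (mv_line f x w) \<le> d"
    unfolding mv_line_def
    by (intro degree_sum_le) (auto intro: order_trans[OF degree_smult_le] p)
  show "coeff (mv_line f x w) d = mv_eval f w"
    by (simp add: mv_line_def mv_eval_def coeff_sum p)
qed

lemma concurrent_lines_imp_dirderiv:
  fixes f :: "(3, 'k::{alg_closed_field, field_char_0}) mvpoly"
  assumes d: "d \<ge> 1" and hom: "mv_homogeneous d f" and lines: "concurrent_lines d (proj_zeros f)"
  shows "\<exists>b. b \<noteq> 0 \<and> mv_dirderiv b f = 0"
proof -
  from lines obtain S p where S: "finite S" "card S = d" "\<forall>L\<in>S. proj_line L"
    and p: "p \<in> proj_space" "\<forall>L\<in>S. p \<in> L" and zeros: "proj_zeros f = \<Union>S"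
    unfolding concurrent_lines_def by (elim exE conjE)
  from p(1) obtain b where b: "b \<noteq> 0" and pb: "p = proj_point b"
    by (auto simp: proj_space_def)
  have mem: "mv_eval f v = 0 \<longleftrightarrow> proj_point v \<in> \<Union>S" if "v \<noteq> 0" for v
    using proj_point_mem_proj_zeros_iff[OF hom that] zeros by simp
  have "S \<noteq> {}" using S d by auto
  then have fb: "mv_eval f b = 0"
    using mem[OF b] p(2) pb by blast
  note f0 = mv_eval_zero_vec[OF hom d]
  have invariant: "mv_eval f (x + t *s b) = 0" if x: "mv_eval f x = 0" for x t
  proof (cases "x = 0 \<or> x + t *s b = 0")
    case True
    \<comment> \<open>The zero vector represents no projective point, so these cases are computed
      directly.\<close>
    then show ?thesis
      using fb f0 mv_eval_homogeneous[OF hom, of t b] by auto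
  next
    case False
    then obtain L where L: "L \<in> S" "proj_point x \<in> L"
      using mem[of x] x by blast
    then obtain l where l: "mv_homogeneous 1 l" "L = proj_zeros l"
      using S(3) unfolding proj_line_def by blast
    have "mv_eval l x = 0" "mv_eval l b = 0"
      using L p(2) False b by (auto simp: pb l(2) proj_point_mem_proj_zeros_iff[OF l(1)])
    then have "mv_eval l (x + t *s b) = 0"
      by (simp add: mv_eval_homogeneous_1[OF l(1)])
    then have "proj_point (x + t *s b) \<in> L"
      using False by (simp add: l(2) proj_point_mem_proj_zeros_iff[OF l(1)])
    then show ?thesis
      using mem[of "x + t *s b"] False L(1) by blast
  qed
  have "mv_eval (mv_dirderiv b f) x = 0" for x
  proof -
    have "pderiv (mv_line f x b) = 0"
    proof (cases "mv_eval f x = 0")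
      case True
      then have "mv_line f x b = 0"
        by (intro poly_ext_char_0) (simp add: invariant)
      then show ?thesis by simp
    next
      case False
      \<comment> \<open>A zero on the line could be translated back to \<open>x\<close>.\<close>
      have "poly (mv_line f x b) t \<noteq> 0" for t
        using invariant[of "x + t *s b" "- t"] False by auto
      then have "degree (mv_line f x b) = 0"
        using alg_closed_imp_poly_has_root by blast
      then show ?thesis by (simp add: pderiv_eq_0_iff)
    qed
    then show ?thesis by (simp add: mv_eval_dirderiv_line)
  qed
  then have "mv_dirderiv b f = 0"
    by (rule mv_eval_eq_0_imp)
  with b show ?thesis by blast
qed

text \<open>Passes from the roots of a dehomogenized binary form to its linear factors.\<close>

lemma prod_mset_homogenize:
  fixes r s :: "'a::field"
  assumes "s \<noteq> 0"
  shows "s ^ size A * (\<Prod>a\<in>#A. r / s - a) = (\<Prod>a\<in>#A. r - a * s)"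
  by (induction A) (use assms in \<open>auto simp: field_simps\<close>)

lemma size_eq_card_if_count_le_1:
  assumes "\<And>a. count A a \<le> 1"
  shows "size A = card (set_mset A)"
proof -
  have "size A = (\<Sum>a\<in>set_mset A. count A a)"
    by (simp add: size_multiset_overloaded_eq)
  also have "\<dots> = (\<Sum>a\<in>set_mset A. 1)"
  proof (rule sum.cong)
    fix a assume "a \<in> set_mset A"
    then have "count A a > 0" by simp
    with assms[of a] show "count A a = 1" by linarith
  qed simp
  finally show ?thesis by simp
qed

text \<open>In a basis \<open>b\<close>, \<open>c\<close>, \<open>e\<close> with
  \<open>f(c) \<noteq> 0\<close>, the form involves only the coordinates \<beta> and \<gamma>. The
  roots of \<open>f(e + t c)\<close> factor it into forms vanishing at \<open>b\<close>, and
  squarefreeness makes the roots distinct.\<close>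

lemma dirderiv_imp_concurrent_lines:
  fixes f :: "(3, 'k::{alg_closed_field, field_char_0}) mvpoly"
  assumes d: "d \<ge> 1" and hom: "mv_homogeneous d f" and f0: "f \<noteq> 0" and sqf: "squarefree f"
    and b: "b \<noteq> 0" "mv_dirderiv b f = 0"
  shows "concurrent_lines d (proj_zeros f)"
proof -
  note translate = mv_eval_translate[OF b(2)]
  obtain c where c: "mv_eval f c \<noteq> 0"
    using f0 mv_eval_eq_0_imp by blast
  \<comment> \<open>A multiple \<open>c\<close> of \<open>b\<close> would be a translate of the
    origin along \<open>b\<close>, where \<open>f\<close> vanishes.\<close>
  have "\<exists>m. triple b c (axis m 1) \<noteq> 0"
  proof (rule ccontr)
    assume "\<not> ?thesis"
    then have par: "b $ i * c $ j = b $ j * c $ i" for i j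
      by (intro triple_axis_eq_0_imp) blast
    obtain k where k: "b $ k \<noteq> 0"
      using b(1) by (auto simp: vec_eq_iff)
    have "c = 0 + (c $ k / b $ k) *s b"
      using par k by (simp add: vec_eq_iff field_simps)
    then have "mv_eval f c = mv_eval f 0"
      using translate[of 0 "c $ k / b $ k"] by simp
    with c mv_eval_zero_vec[OF hom d] show False by simp
  qed
  then obtain e :: "'k^3" where e: "triple b c e \<noteq> 0" by blast
  \<comment> \<open>Coordinates in the basis \<open>b\<close>, \<open>c\<close>, \<open>e\<close>,
    by Cramer's rule.\<close>
  define \<alpha> where "\<alpha> v = triple v c e / triple b c e" for v
  define \<beta> where "\<beta> v = triple b v e / triple b c e" for v
  define \<gamma> where "\<gamma> v = triple b c v / triple b c e" for v
  have decomp: "v = (\<beta> v *s c + \<gamma> v *s e) + \<alpha> v *s b" for v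
  proof -
    have "triple b c e *s v = (triple b v e *s c + triple b c v *s e) + triple v c e *s b"
      by (simp add: vec_eq_iff forall_3 triple_def algebra_simps)
    then show ?thesis
      using e by (simp add: vec_eq_iff \<alpha>_def \<beta>_def \<gamma>_def field_simps)
  qed
  have coord: "\<beta> b = 0" "\<gamma> b = 0" "\<beta> (a *s c + e) = a" "\<gamma> (a *s c + e) = 1" "\<gamma> 0 = 0" for a
    using e by (simp_all add: \<beta>_def \<gamma>_def divide_simps) (simp_all add: triple_def algebra_simps)
  define L :: "'k \<Rightarrow> (3, 'k) mvpoly" where
    "L a = (\<Sum>i\<in>UNIV. mv_const (\<beta> (axis i 1) - a * \<gamma> (axis i 1)) * mv_var i)" for a
  have L_hom: "mv_homogeneous 1 (L a)" for a
    unfolding L_def by (rule mv_homogeneous_linear_form)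
  have L: "mv_eval (L a) v = \<beta> v - a * \<gamma> v" for a v
    using e by (simp add: L_def sum_3 \<beta>_def \<gamma>_def divide_simps)
      (simp add: triple_def axis_def algebra_simps)
  define q where "q = mv_line f e c"
  have q: "degree q = d" "lead_coeff q = mv_eval f c"
    using mv_line_homogeneous[OF hom, of e c] c
    unfolding q_def by (metis le_antisym le_degree)+
  then have "q \<noteq> 0" using c by auto
  then obtain A where A: "size A = d" "q = smult (mv_eval f c) (\<Prod>a\<in>#A. [:- a, 1:])"
    using alg_closed_imp_factorization[of q] q by metis
  have poly_q: "poly q t = mv_eval f c * (\<Prod>a\<in>#A. t - a)" for t
    by (subst A) (simp add: poly_prod_mset image_mset.compositionality o_def)
  have binary: "mv_eval f (r *s c + s *s e) = mv_eval f c * (\<Prod>a\<in>#A. r - a * s)" for r s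
  proof (cases "s = 0")
    case True
    then show ?thesis by (simp add: mv_eval_homogeneous[OF hom] A)
  next
    case False
    then have "r *s c + s *s e = s *s (e + (r / s) *s c)"
      by (simp add: vec_eq_iff algebra_simps)
    then have "mv_eval f (r *s c + s *s e) = s ^ d * poly q (r / s)"
      by (simp only: mv_eval_homogeneous[OF hom] q_def poly_mv_line)
    then show ?thesis
      using prod_mset_homogenize[OF False, of A r] A(1) by (simp add: poly_q mult_ac)
  qed
  have f_eval: "mv_eval f v = mv_eval f c * (\<Prod>a\<in>#A. \<beta> v - a * \<gamma> v)" for v
    using translate[of "\<beta> v *s c + \<gamma> v *s e" "\<alpha> v"] binary[of "\<beta> v" "\<gamma> v"]
    by (simp add: decomp[symmetric])
  have f_eq: "f = mv_const (mv_eval f c) * (\<Prod>a\<in>#A. L a)"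
    by (rule mv_eval_eqI) (simp add: L f_eval[symmetric])
  have "count A a \<le> 1" for a
  proof (rule ccontr)
    assume "\<not> count A a \<le> 1"
    then have "{#a, a#} \<subseteq># A"
      by (simp add: subseteq_mset_def)
    then obtain B where "A = {#a, a#} + B"
      by (metis subset_mset.add_diff_inverse)
    \<comment> \<open>A repeated root gives a square factor, so \<open>L a\<close> would be a unit,
      although it vanishes at \<open>b\<close>.\<close>
    then have "f = (L a)\<^sup>2 * (mv_const (mv_eval f c) * (\<Prod>a\<in>#B. L a))"
      using f_eq by (simp add: power2_eq_square mult_ac)
    then have "L a dvd 1"
      using sqf unfolding squarefree_def by (metis dvd_triv_left)
    then obtain g where "1 = L a * g" by blast
    from arg_cong[OF this, of "\<lambda>p. mv_eval p b"] show False
      by (simp add: L coord)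
  qed
  then have card: "card (set_mset A) = d"
    using size_eq_card_if_count_le_1 A by metis
  have point: "a *s c + e \<noteq> 0" for a
    using coord(4)[of a] coord(5) by (metis zero_neq_one)
  have "mv_eval (L a) ((a + 1) *s c + e) = 1" for a
    unfolding L coord by simp
  then have L_nz: "L a \<noteq> 0" for a
    by (metis mv_eval_zero zero_neq_one)
  have inj: "inj_on (\<lambda>a. proj_zeros (L a)) (set_mset A)"
  proof (rule inj_onI)
    fix a a' assume eq: "proj_zeros (L a) = proj_zeros (L a')"
    \<comment> \<open>At \<open>a *s c + e\<close> the form \<open>L a'\<close> takes the value
      \<open>a - a'\<close>, so this point tells the lines apart.\<close>
    have "proj_point (a *s c + e) \<in> proj_zeros (L a)"
      by (simp add: proj_point_mem_proj_zeros_iff[OF L_hom point] L coord)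
    then show "a = a'"
      unfolding eq by (simp add: proj_point_mem_proj_zeros_iff[OF L_hom point] L coord)
  qed
  have "proj_zeros f = (\<Union>a\<in>set_mset A. proj_zeros (L a))"
  proof -
    have "P \<in> proj_zeros f \<longleftrightarrow> P \<in> (\<Union>a\<in>set_mset A. proj_zeros (L a))" if "P \<in> proj_space" for P
    proof -
      from that obtain v where v: "v \<noteq> 0" "P = proj_point v"
        by (auto simp: proj_space_def)
      have "mv_eval f v = 0 \<longleftrightarrow> (\<exists>a\<in>set_mset A. \<beta> v - a * \<gamma> v = 0)"
        unfolding f_eval[of v] using c by (auto simp: prod_mset_zero_iff)
      then show ?thesis
        unfolding v(2) UN_iff by (simp only: proj_point_mem_proj_zeros_iff[OF hom v(1)] proj_point_mem_proj_zeros_iff[OF L_hom v(1)] L)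
    qed
    then show ?thesis by (auto simp: proj_zeros_def)
  qed
  moreover have "proj_point b \<in> proj_zeros (L a)" for a
    by (simp add: proj_point_mem_proj_zeros_iff[OF L_hom b(1)] L coord)
  moreover have "proj_line (proj_zeros (L a))" for a
    unfolding proj_line_def using L_hom L_nz by blast
  moreover have "proj_point b \<in> proj_space"
    unfolding proj_space_def using b(1) by blast
  ultimately show ?thesis
    unfolding concurrent_lines_def
    by (intro exI[of _ "(\<lambda>a. proj_zeros (L a)) ` set_mset A"] exI[of _ "proj_point b"])
      (auto simp: card_image[OF inj] card)
qed

theorem proposition3p4:
  fixes f :: "(3, 'k::{alg_closed_field, field_char_0}) mvpoly" and d :: nat
  assumes "d \<ge> 2"
    and "f \<noteq> 0" and "mv_homogeneous d f"
    and "squarefree f"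
  shows "(hessian_poly f = 0 \<longleftrightarrow> is_cone f) \<and>
         (is_cone f \<longleftrightarrow> concurrent_lines d (proj_zeros f))"
proof
  show "hessian_poly f = 0 \<longleftrightarrow> is_cone f"
    by (rule hessian_poly_eq_0_iff_is_cone) fact+
  have d: "d \<ge> 1" using assms(1) by simp
  show "is_cone f \<longleftrightarrow> concurrent_lines d (proj_zeros f)"
    unfolding is_cone_iff_dirderiv
  proof
    assume "\<exists>b. b \<noteq> 0 \<and> mv_dirderiv b f = 0"
    then show "concurrent_lines d (proj_zeros f)"
      using dirderiv_imp_concurrent_lines[OF d assms(3,2,4)] by blast
  qed (rule concurrent_lines_imp_dirderiv[OF d assms(3)])
qed

end
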